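(* Let $K$-independent data $\dot E=(E,C,D)$ be a bi-separated graph, let $\mathcal{C}$ be a connected component of the category $\mathbf{RG}(\dot E)$ of representation graphs for $\dot E$, and let $(S_{\mathcal{C}},\xi_{\mathcal{C}})$ be the object of $\mathcal{C}$ constructed in the context. Then $(S_{\mathcal{C}},\xi_{\mathcal{C}})$ is an attracting object of $\mathcal{C}$ (i.e. every object of $\mathcal{C}$ admits a morphism to it), and consequently the objects of $\mathcal{C}$ are precisely the representation graphs $(G,\xi_{\mathcal{C}}\circ\alpha)$ where $(G,\alpha)$ is a covering of $S_{\mathcal{C}}$.
   Context: Graphs. A (directed) graph is a quadruple $E=(E^0,E^1,s,r)$ with sets $E^0$ (vertices), $E^1$ (edges) and maps $s,r:E^1\to E^0$ (source, range). A graph homomorphism $\phi:F\to E$ is a pair of maps $\phi^0:F^0\to E^0$, $\phi^1:F^1\to E^1$ with $s(\phi^1(e))=\phi^0(s(e))$, $r(\phi^1(e))=\phi^0(r(e))$; both are written $\phi$. The double graph $\hat E$ has vertex set $E^0$ and edges $e,e^*$ ($e\in E^1$), with $e$ as in $E$ and $e^*$ having source $r(e)$ and range $s(e)$. A walk in $E$ is a path in $\hat E$: either a single vertex (trivial walk) or a finite nonempty sequence $x_1\dots x_n$ of edges of $\hat E$ with $r(x_i)=s(x_{i+1})$. $\operatorname{Walk}(E)$ is the set of walks and ${}_u\!\operatorname{Walk}(E)$ the set of walks starting in $u$. A graph homomorphism induces a map on walks (with $\phi(e^* )=\phi(e)^*$). All graphs are assumed to have at least one vertex and to be connected, i.e.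 for all vertices $u,v$ there is a walk from $u$ to $v$. Coverings. A covering of a graph $E$ is a pair $(F,\phi)$ with $\phi:F\to E$ a graph homomorphism such that for every $v\in F^0$ the restrictions $\phi^1:s^{-1}(v)\to s^{-1}(\phi^0(v))$ and $\phi^1:r^{-1}(v)\to r^{-1}(\phi^0(v))$ are bijective. A morphism of coverings $(F,\phi)\to(G,\psi)$ is a graph homomorphism $\alpha:F\to G$ with $\psi\circ\alpha=\phi$. A covering of $E$ is universal if it admits a morphism to every covering of $E$; every (connected) graph has a universal covering. Bi-separated graphs. A bi-separated graph is a triple $\dot E=(E,C,D)$ with $E$ a graph, $C=\bigsqcup_{v\in E^0}C_v$ with $C_v$ a partition of $s^{-1}(v)$, $D=\bigsqcup_{v\in E^0}D_v$ with $D_v$ a partition of $r^{-1}(v)$, and $|X\cap Y|\le 1$ for all $X\in C$, $Y\in D$. All bi-separated graphs are assumed finitely bi-separated: every $X\in C$ and every $Y\in D$ is a finite set. Representation graphs. A representation graph for $\dot E$ is a pair $(F,\phi)$ with $F$ a graph and $\phi:F\to E$ a graph homomorphism such that (i) for any $w\in F^0$ and $X\in C_{\phi(w)}$ there is precisely one $f\in s^{-1}(w)$ with $\phi(f)\in X$; (ii) for any $w\in F^0$ and $Y\in D_{\phi(w)}$ there is precisely one $f\in r^{-1}(w)$ with $\phi(f)\in Y$. $\mathbf{RG}(\dot E)$ is the category of representation graphs for $\dot E$; a morphism $(F,\phi)\to(G,\psi)$ is a graph homomorphism $\alpha:F\to G$ with $\psi\circ\alpha=\phi$. The connected components of a category are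 the full subcategories on the classes of objects linked by finite zigzags of morphisms. Quotients. For a representation graph $(F,\phi)$ define $u\sim v$ on $F^0$ iff $\phi({}_u\!\operatorname{Walk}(F))=\phi({}_v\!\operatorname{Walk}(F))$. An equivalence relation $\approx$ on $F^0$ is admissible if $u\approx v$ implies $u\sim v$, and if $p,q\in\operatorname{Walk}(F)$, $\phi(p)=\phi(q)$, $s(p)\approx s(q)$ imply $r(p)\approx r(q)$ (the relation $\sim$ is admissible). For admissible $\approx$, write $f\approx g$ for $f,g\in F^1$ if $s(f)\approx s(g)$ and $\phi(f)=\phi(g)$; the quotient $(F_\approx,\phi_\approx)$ is the representation graph with $F_\approx^0=F^0/\!\approx$, $F_\approx^1=F^1/\!\approx$, $s([f])=[s(f)]$, $r([f])=[r(f)]$, $\phi_\approx([v])=\phi(v)$, $\phi_\approx([f])=\phi(f)$. The objects $(T_{\mathcal C},\zeta_{\mathcal C})$ and $(S_{\mathcal C},\xi_{\mathcal C})$. For a connected component $\mathcal{C}$ choose an object $(F,\phi)$ of $\mathcal{C}$ and a universal covering $(T,\tau)$ of $F$. Then $(T_{\mathcal{C}},\zeta_{\mathcal{C}}):=(T,\phi\circ\tau)$ is an object of $\mathcal{C}$, and $(S_{\mathcal{C}},\xi_{\mathcal{C}}):=((T_{\mathcal{C}})_\sim,(\zeta_{\mathcal{C}})_\sim)$. *)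

theory Defs
  imports "Graph_Theory.Digraph" "Graph_Theory.Arc_Walk" "HOL-Library.Disjoint_Sets"
begin

section \<open>Graphs, walks and homomorphisms\<close>

definition double_graph :: "('v, 'e) pre_digraph \<Rightarrow> ('v, 'e + 'e) pre_digraph" where
  "double_graph E =
     \<lparr> verts = verts E, arcs = arcs E <+> arcs E,
       tail = case_sum (tail E) (head E), head = case_sum (head E) (tail E) \<rparr>"

text \<open>A walk is recorded by its start vertex together with its list of edges, so that the
  trivial walks at different vertices are different walks.\<close>

abbreviation walk :: "('v, 'e) pre_digraph \<Rightarrow> 'v \<Rightarrow> ('e + 'e) list \<Rightarrow> 'v \<Rightarrow> bool" where
  "walk E \<equiv> pre_digraph.awalk (double_graph E)"

definition walks_from :: "('v, 'e) pre_digraph \<Rightarrow> 'v \<Rightarrow> ('v \<times> ('e + 'e) list) set" where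
  "walks_from E u = {(u, p) | p. \<exists>v. walk E u p v}"

definition connected_graph :: "('v, 'e) pre_digraph \<Rightarrow> bool" where
  "connected_graph E \<longleftrightarrow> wf_digraph E \<and> verts E \<noteq> {} \<and>
     (\<forall>u\<in>verts E. \<forall>v\<in>verts E. \<exists>p. walk E u p v)"

type_synonym ('v, 'e, 'w, 'f) graph_map = "('v \<Rightarrow> 'w) \<times> ('e \<Rightarrow> 'f)"

definition graph_hom ::
    "('v, 'e) pre_digraph \<Rightarrow> ('w, 'f) pre_digraph \<Rightarrow> ('v, 'e, 'w, 'f) graph_map \<Rightarrow> bool" where
  "graph_hom F E \<phi> \<longleftrightarrow>
     (\<forall>v\<in>verts F. fst \<phi> v \<in> verts E) \<and>
     (\<forall>e\<in>arcs F. snd \<phi> e \<in> arcs E \<and>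
        tail E (snd \<phi> e) = fst \<phi> (tail F e) \<and> head E (snd \<phi> e) = fst \<phi> (head F e))"

definition map_comp_graph ::
    "('w, 'f, 'a, 'b) graph_map \<Rightarrow> ('v, 'e, 'w, 'f) graph_map \<Rightarrow> ('v, 'e, 'a, 'b) graph_map"
    (infixl \<open>\<circ>\<^sub>g\<close> 55) where
  "\<psi> \<circ>\<^sub>g \<phi> = (fst \<psi> \<circ> fst \<phi>, snd \<psi> \<circ> snd \<phi>)"

text \<open>Maps of graphs are total functions on the underlying types; they are compared only on the
  vertices and edges of their domain graph.\<close>

definition map_eq_on ::
    "('v, 'e) pre_digraph \<Rightarrow> ('v, 'e, 'a, 'b) graph_map \<Rightarrow> ('v, 'e, 'a, 'b) graph_map \<Rightarrow> bool" where
  "map_eq_on F \<phi> \<psi> \<longleftrightarrow>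
     (\<forall>v\<in>verts F. fst \<phi> v = fst \<psi> v) \<and> (\<forall>e\<in>arcs F. snd \<phi> e = snd \<psi> e)"

definition walk_map ::
    "('v, 'e, 'a, 'b) graph_map \<Rightarrow> 'v \<times> ('e + 'e) list \<Rightarrow> 'a \<times> ('b + 'b) list" where
  "walk_map \<phi> = map_prod (fst \<phi>) (map (map_sum (snd \<phi>) (snd \<phi>)))"

section \<open>Graphs over a graph\<close>

text \<open>Coverings of \<open>E\<close> and representation graphs for a bi-separated graph on \<open>E\<close> are
  pairs \<open>(F, \<phi>)\<close> with \<open>\<phi>\<close> a homomorphism from \<open>F\<close> to \<open>E\<close>,
  and they have the same morphisms.\<close>

type_synonym ('v, 'e, 'a, 'b) over_graph = "('v, 'e) pre_digraph \<times> ('v, 'e, 'a, 'b) graph_map"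

fun over_morphism ::
    "('v, 'e, 'a, 'b) over_graph \<Rightarrow> ('w, 'f, 'a, 'b) over_graph \<Rightarrow> ('v, 'e, 'w, 'f) graph_map \<Rightarrow> bool"
  where
  "over_morphism (F, \<phi>) (G, \<psi>) \<alpha> \<longleftrightarrow> graph_hom F G \<alpha> \<and> map_eq_on F (\<psi> \<circ>\<^sub>g \<alpha>) \<phi>"

definition over_iso :: "('v, 'e, 'a, 'b) over_graph \<Rightarrow> ('w, 'f, 'a, 'b) over_graph \<Rightarrow> bool" where
  "over_iso X Y \<longleftrightarrow> (\<exists>\<alpha> \<beta>. over_morphism X Y \<alpha> \<and> over_morphism Y X \<beta> \<and>
     map_eq_on (fst X) (\<beta> \<circ>\<^sub>g \<alpha>) (id, id) \<and> map_eq_on (fst Y) (\<alpha> \<circ>\<^sub>g \<beta>) (id, id))"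

text \<open>One cannot quantify over all types inside a formula. In a graph over \<open>E\<close> that is a
  covering or a representation graph, a walk from a fixed base vertex is determined by its image in
  \<open>E\<close>. Hence a vertex can be named by the image of some walk leading to it, and an edge by
  its source and its image; every such graph is isomorphic over \<open>E\<close> to one of the
  following type (see \<open>covering_std\<close> and \<open>representation_graph_std\<close> below). So
  quantifying over graphs of this type is quantifying over all of them up to isomorphism.\<close>

type_synonym ('a, 'b) std_over_graph =
  "(('b + 'b) list, ('b + 'b) list \<times> 'b, 'a, 'b) over_graph"

section \<open>Coverings\<close>

fun covering :: "('a, 'b) pre_digraph \<Rightarrow> ('v, 'e, 'a, 'b) over_graph \<Rightarrow> bool" where
  "covering E (F, \<phi>) \<longleftrightarrow> connected_graph F \<and> graph_hom F E \<phi> \<and>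
     (\<forall>v\<in>verts F. bij_betw (snd \<phi>) (out_arcs F v) (out_arcs E (fst \<phi> v)) \<and>
                  bij_betw (snd \<phi>) (in_arcs F v) (in_arcs E (fst \<phi> v)))"

text \<open>The restriction to coverings of the standard type is harmless:
  see \<open>universal_covering_all_types\<close> below.\<close>

definition universal_covering :: "('a, 'b) pre_digraph \<Rightarrow> ('v, 'e, 'a, 'b) over_graph \<Rightarrow> bool" where
  "universal_covering E T \<longleftrightarrow> covering E T \<and>
     (\<forall>G :: ('a, 'b) std_over_graph. covering E G \<longrightarrow> (\<exists>\<alpha>. over_morphism T G \<alpha>))"

section \<open>Bi-separated graphs and representation graphs\<close>

text \<open>The families \<open>C v\<close> and \<open>D v\<close> of partitions are given as
  functions of the vertex. The sets \<open>C v\<close> are pairwise disjoint because blocks are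
  nonempty and their elements have source \<open>v\<close>; likewise for \<open>D\<close>.\<close>

definition bi_separated ::
    "('a, 'b) pre_digraph \<Rightarrow> ('a \<Rightarrow> 'b set set) \<Rightarrow> ('a \<Rightarrow> 'b set set) \<Rightarrow> bool" where
  "bi_separated E C D \<longleftrightarrow> connected_graph E \<and>
     (\<forall>v\<in>verts E. partition_on (out_arcs E v) (C v)) \<and>
     (\<forall>v\<in>verts E. partition_on (in_arcs E v) (D v)) \<and>
     (\<forall>X\<in>(\<Union>v\<in>verts E. C v). finite X) \<and>
     (\<forall>Y\<in>(\<Union>v\<in>verts E. D v). finite Y) \<and>
     (\<forall>X\<in>(\<Union>v\<in>verts E. C v). \<forall>Y\<in>(\<Union>v\<in>verts E. D v). card (X \<inter> Y) \<le> 1)"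

fun representation_graph ::
    "('a, 'b) pre_digraph \<Rightarrow> ('a \<Rightarrow> 'b set set) \<Rightarrow> ('a \<Rightarrow> 'b set set) \<Rightarrow>
     ('v, 'e, 'a, 'b) over_graph \<Rightarrow> bool" where
  "representation_graph E C D (F, \<phi>) \<longleftrightarrow> connected_graph F \<and> graph_hom F E \<phi> \<and>
     (\<forall>w\<in>verts F. \<forall>X\<in>C (fst \<phi> w). \<exists>!f. f \<in> out_arcs F w \<and> snd \<phi> f \<in> X) \<and>
     (\<forall>w\<in>verts F. \<forall>Y\<in>D (fst \<phi> w). \<exists>!f. f \<in> in_arcs F w \<and> snd \<phi> f \<in> Y)"

section \<open>Connected components of the category of representation graphs\<close>

definition RG ::
    "('a, 'b) pre_digraph \<Rightarrow> ('a \<Rightarrow> 'b set set) \<Rightarrow> ('a \<Rightarrow> 'b set set) \<Rightarrow>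
     ('a, 'b) std_over_graph set" where
  "RG E C D = {X. representation_graph E C D X}"

definition RG_arrows ::
    "('a, 'b) pre_digraph \<Rightarrow> ('a \<Rightarrow> 'b set set) \<Rightarrow> ('a \<Rightarrow> 'b set set) \<Rightarrow>
     ('a, 'b) std_over_graph rel" where
  "RG_arrows E C D = {(X, Y). X \<in> RG E C D \<and> Y \<in> RG E C D \<and> (\<exists>\<alpha>. over_morphism X Y \<alpha>)}"

definition RG_components ::
    "('a, 'b) pre_digraph \<Rightarrow> ('a \<Rightarrow> 'b set set) \<Rightarrow> ('a \<Rightarrow> 'b set set) \<Rightarrow>
     ('a, 'b) std_over_graph set set" where
  "RG_components E C D = RG E C D // (RG_arrows E C D \<union> (RG_arrows E C D)\<inverse>)\<^sup>*"

text \<open>Membership in a component for representation graphs whose vertices and edges may have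
  any type: being isomorphic to a member of standard type. Every representation graph
  lies in exactly one component, and morphisms between representation graphs of any types stay
  within a component (\<open>in_component_ex1\<close> and \<open>in_component_morphism\<close>
  below).\<close>

definition in_component ::
    "('a, 'b) pre_digraph \<Rightarrow> ('a \<Rightarrow> 'b set set) \<Rightarrow> ('a \<Rightarrow> 'b set set) \<Rightarrow>
     ('a, 'b) std_over_graph set \<Rightarrow> ('v, 'e, 'a, 'b) over_graph \<Rightarrow> bool" where
  "in_component E C D \<C> X \<longleftrightarrow> representation_graph E C D X \<and> (\<exists>Y\<in>\<C>. over_iso X Y)"

section \<open>Quotients\<close>

fun walk_equiv :: "('v, 'e, 'a, 'b) over_graph \<Rightarrow> 'v rel" where
  "walk_equiv (F, \<phi>) = {(u, v). u \<in> verts F \<and> v \<in> verts F \<and>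
     walk_map \<phi> ` walks_from F u = walk_map \<phi> ` walks_from F v}"

fun arc_equiv :: "('v, 'e, 'a, 'b) over_graph \<Rightarrow> 'v rel \<Rightarrow> 'e rel" where
  "arc_equiv (F, \<phi>) R = {(f, g). f \<in> arcs F \<and> g \<in> arcs F \<and>
     (tail F f, tail F g) \<in> R \<and> snd \<phi> f = snd \<phi> g}"

text \<open>For an admissible relation, the unions and images below run over constant families;
  \<open>quotient_walk_equiv_simps\<close> below gives the values on classes
  for the relation \<open>walk_equiv\<close>.\<close>

fun quotient_over_graph ::
    "('v, 'e, 'a, 'b) over_graph \<Rightarrow> 'v rel \<Rightarrow> ('v set, 'e set, 'a, 'b) over_graph" where
  "quotient_over_graph (F, \<phi>) R =
     (\<lparr> verts = verts F // R, arcs = arcs F // arc_equiv (F, \<phi>) R,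
        tail = (\<lambda>A. \<Union>f\<in>A. R `` {tail F f}), head = (\<lambda>A. \<Union>f\<in>A. R `` {head F f}) \<rparr>,
      (\<lambda>V. the_elem (fst \<phi> ` V), \<lambda>A. the_elem (snd \<phi> ` A)))"

section \<open>Independence of the types\<close>

lemma double_graph_simps [simp]:
  "verts (double_graph E) = verts E"
  "arcs (double_graph E) = arcs E <+> arcs E"
  "tail (double_graph E) (Inl e) = tail E e"
  "tail (double_graph E) (Inr e) = head E e"
  "head (double_graph E) (Inl e) = head E e"
  "head (double_graph E) (Inr e) = tail E e"
  by (simp_all add: double_graph_def)

lemma wf_double_graph: "wf_digraph E \<Longrightarrow> wf_digraph (double_graph E)"
  by (auto simp: wf_digraph_def)

lemma walk_Nil [simp]: "walk E u [] v \<longleftrightarrow> u = v \<and> u \<in> verts E"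
  by (auto simp: pre_digraph.awalk_def pre_digraph.cas.simps)

lemma walk_Cons:
  "wf_digraph E \<Longrightarrow> walk E u (e # p) v \<longleftrightarrow> e \<in> arcs E <+> arcs E \<and>
     u = tail (double_graph E) e \<and> walk E (head (double_graph E) e) p v"
  by (simp add: wf_digraph.awalk_Cons_iff wf_double_graph)

lemma connected_graphD:
  assumes "connected_graph F"
  shows "wf_digraph F" "verts F \<noteq> {}" "e \<in> arcs F \<Longrightarrow> tail F e \<in> verts F"
    "e \<in> arcs F \<Longrightarrow> head F e \<in> verts F"
  using assms by (auto simp: connected_graph_def wf_digraph_def)

lemma walk_hom:
  assumes "wf_digraph F" "wf_digraph G" "graph_hom F G \<alpha>" "walk F u p v"
  shows "walk G (fst \<alpha> u) (map (map_sum (snd \<alpha>) (snd \<alpha>)) p) (fst \<alpha> v)"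
  using assms(4)
proof (induction p arbitrary: u)
  case Nil
  with assms(3) show ?case by (auto simp: graph_hom_def)
next
  case (Cons e p)
  then show ?case using assms(3)
    by (cases e) (auto simp: walk_Cons[OF assms(1)] walk_Cons[OF assms(2)] graph_hom_def)
qed

lemma walk_lift_unique:
  assumes wf: "wf_digraph F"
    and out: "\<And>v. v \<in> verts F \<Longrightarrow> inj_on (snd \<phi>) (out_arcs F v)"
    and "in": "\<And>v. v \<in> verts F \<Longrightarrow> inj_on (snd \<phi>) (in_arcs F v)"
    and "walk F u p v" "walk F u q w"
    and "map (map_sum (snd \<phi>) (snd \<phi>)) p = map (map_sum (snd \<phi>) (snd \<phi>)) q"
  shows "p = q \<and> v = w"
  using assms(4-)
proof (induction p arbitrary: u q)
  case Nil
  then show ?case by auto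
next
  case (Cons e p)
  then obtain e' q' where q: "q = e' # q'" by (cases q) auto
  have "e = e'"
  proof (cases e)
    case (Inl f)
    then obtain f' where f': "e' = Inl f'" "snd \<phi> f = snd \<phi> f'"
      using Cons.prems(3) q by (cases e') auto
    have "f \<in> out_arcs F u" "f' \<in> out_arcs F u"
      using Cons.prems(1,2) q Inl f' by (auto simp: walk_Cons[OF wf] out_arcs_def)
    moreover have "u \<in> verts F" using Cons.prems(1) by (simp add: pre_digraph.awalk_def)
    ultimately show ?thesis using out[of u] f' Inl by (auto dest: inj_onD)
  next
    case (Inr f)
    then obtain f' where f': "e' = Inr f'" "snd \<phi> f = snd \<phi> f'"
      using Cons.prems(3) q by (cases e') auto
    have "f \<in> in_arcs F u" "f' \<in> in_arcs F u"
      using Cons.prems(1,2) q Inr f' by (auto simp: walk_Cons[OF wf] in_arcs_def)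
    moreover have "u \<in> verts F" using Cons.prems(1) by (simp add: pre_digraph.awalk_def)
    ultimately show ?thesis using "in"[of u] f' Inr by (auto dest: inj_onD)
  qed
  with Cons q show ?case by (auto simp: walk_Cons[OF wf])
qed

lemma over_morphism_comp:
  assumes "over_morphism X Y \<alpha>" "over_morphism Y Z \<beta>"
  shows "over_morphism X Z (\<beta> \<circ>\<^sub>g \<alpha>)"
  using assms
  by (cases X; cases Y; cases Z) (auto simp: graph_hom_def map_eq_on_def map_comp_graph_def)

lemma over_iso_sym: "over_iso X Y \<Longrightarrow> over_iso Y X"
  unfolding over_iso_def by blast

lemma over_iso_morphisms:
  assumes "over_iso X Y"
  shows "\<exists>\<alpha>. over_morphism X Y \<alpha>" "\<exists>\<alpha>. over_morphism Y X \<alpha>"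
  using assms unfolding over_iso_def by blast+

lemma over_isoE:
  assumes iso: "over_iso (F, \<phi>) (G, \<psi>)" and wf: "wf_digraph F" "wf_digraph G"
  obtains \<alpha> where "over_morphism (F, \<phi>) (G, \<psi>) \<alpha>"
    "fst \<alpha> ` verts F = verts G"
    "\<And>v. v \<in> verts F \<Longrightarrow> bij_betw (snd \<alpha>) (out_arcs F v) (out_arcs G (fst \<alpha> v))"
    "\<And>v. v \<in> verts F \<Longrightarrow> bij_betw (snd \<alpha>) (in_arcs F v) (in_arcs G (fst \<alpha> v))"
proof -
  from iso obtain \<alpha> \<beta> where \<alpha>: "over_morphism (F, \<phi>) (G, \<psi>) \<alpha>" and \<beta>: "over_morphism (G, \<psi>) (F, \<phi>) \<beta>"
    and \<beta>\<alpha>: "map_eq_on F (\<beta> \<circ>\<^sub>g \<alpha>) (id, id)" and \<alpha>\<beta>: "map_eq_on G (\<alpha> \<circ>\<^sub>g \<beta>) (id, id)"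
    by (auto simp: over_iso_def)
  have inv: "\<And>v. v \<in> verts F \<Longrightarrow> fst \<beta> (fst \<alpha> v) = v" "\<And>e. e \<in> arcs F \<Longrightarrow> snd \<beta> (snd \<alpha> e) = e"
    "\<And>v. v \<in> verts G \<Longrightarrow> fst \<alpha> (fst \<beta> v) = v" "\<And>e. e \<in> arcs G \<Longrightarrow> snd \<alpha> (snd \<beta> e) = e"
    using \<beta>\<alpha> \<alpha>\<beta> by (auto simp: map_eq_on_def map_comp_graph_def)
  have h\<alpha>: "graph_hom F G \<alpha>" and h\<beta>: "graph_hom G F \<beta>" using \<alpha> \<beta> by auto
  show thesis
  proof
    show "over_morphism (F, \<phi>) (G, \<psi>) \<alpha>" by (fact \<alpha>)
    show "fst \<alpha> ` verts F = verts G"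
    proof (intro equalityI subsetI)
      fix v assume "v \<in> verts G"
      then have "fst \<alpha> (fst \<beta> v) = v" "fst \<beta> v \<in> verts F"
        using inv(3) h\<beta> by (simp_all add: graph_hom_def)
      then show "v \<in> fst \<alpha> ` verts F" by (metis imageI)
    qed (use h\<alpha> in \<open>auto simp: graph_hom_def\<close>)
    fix v assume v: "v \<in> verts F"
    show "bij_betw (snd \<alpha>) (out_arcs F v) (out_arcs G (fst \<alpha> v))"
      by (rule bij_betw_byWitness[where f' = "snd \<beta>"])
        (use h\<alpha> h\<beta> inv v in \<open>auto simp: out_arcs_def graph_hom_def\<close>)
    show "bij_betw (snd \<alpha>) (in_arcs F v) (in_arcs G (fst \<alpha> v))"
      by (rule bij_betw_byWitness[where f' = "snd \<beta>"])
        (use h\<alpha> h\<beta> inv v in \<open>auto simp: in_arcs_def graph_hom_def\<close>)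
  qed
qed

lemma over_iso_connected:
  assumes "over_iso (F, \<phi>) (G, \<psi>)" "wf_digraph G" "connected_graph F"
  shows "connected_graph G"
proof -
  have wf: "wf_digraph F" using assms(3) by (rule connected_graphD)
  obtain \<alpha> where \<alpha>: "over_morphism (F, \<phi>) (G, \<psi>) \<alpha>" "fst \<alpha> ` verts F = verts G"
    by (rule over_isoE[OF assms(1) wf assms(2)])
  have "\<exists>p. walk G (fst \<alpha> u) p (fst \<alpha> v)" if uv: "u \<in> verts F" "v \<in> verts F" for u v
  proof -
    obtain p where "walk F u p v" using assms(3) uv unfolding connected_graph_def by blast
    with walk_hom[OF wf assms(2)] \<alpha>(1) show ?thesis by fastforce
  qed
  then have "\<forall>u\<in>verts G. \<forall>v\<in>verts G. \<exists>p. walk G u p v"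
    unfolding \<alpha>(2)[symmetric] by blast
  moreover have "verts G \<noteq> {}" using assms(3) \<alpha>(2) by (auto simp: connected_graph_def)
  ultimately show ?thesis using assms(2) by (simp add: connected_graph_def)
qed

lemma over_iso_hom:
  assumes "over_iso (F, \<phi>) (G, \<psi>)" "wf_digraph G" "graph_hom F E \<phi>"
  shows "graph_hom G E \<psi>"
proof -
  obtain \<beta> where "over_morphism (G, \<psi>) (F, \<phi>) \<beta>" using over_iso_morphisms[OF assms(1)] by blast
  then have \<beta>: "graph_hom G F \<beta>" "map_eq_on G (\<phi> \<circ>\<^sub>g \<beta>) \<psi>" by auto
  have tG: "tail G e \<in> verts G" "head G e \<in> verts G" if "e \<in> arcs G" for e
    using assms(2) that by (auto simp: wf_digraph_def)
  show ?thesis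
    unfolding graph_hom_def
  proof (intro conjI ballI)
    fix v assume "v \<in> verts G"
    then have "fst \<psi> v = fst \<phi> (fst \<beta> v)" "fst \<beta> v \<in> verts F"
      using \<beta> by (simp_all add: map_eq_on_def map_comp_graph_def graph_hom_def)
    then show "fst \<psi> v \<in> verts E" using assms(3) by (simp add: graph_hom_def)
  next
    fix e assume e: "e \<in> arcs G"
    have eq: "snd \<psi> e = snd \<phi> (snd \<beta> e)" "fst \<psi> (tail G e) = fst \<phi> (fst \<beta> (tail G e))"
      "fst \<psi> (head G e) = fst \<phi> (fst \<beta> (head G e))"
      using \<beta>(2) e tG[OF e] by (simp_all add: map_eq_on_def map_comp_graph_def)
    show "snd \<psi> e \<in> arcs E" "tail E (snd \<psi> e) = fst \<psi> (tail G e)"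
      "head E (snd \<psi> e) = fst \<psi> (head G e)"
      unfolding eq using \<beta>(1) assms(3) e by (auto simp: graph_hom_def)
  qed
qed

lemma over_iso_covering:
  assumes "over_iso X Y" "wf_digraph (fst Y)" "covering E X"
  shows "covering E Y"
proof -
  obtain F \<phi> G \<psi> where XY: "X = (F, \<phi>)" "Y = (G, \<psi>)" by (cases X; cases Y)
  have iso: "over_iso (F, \<phi>) (G, \<psi>)" and wfG: "wf_digraph G" and cov: "covering E (F, \<phi>)"
    using assms by (auto simp: XY)
  have wfF: "wf_digraph F" using cov by (auto intro: connected_graphD)
  obtain \<beta> where \<beta>: "over_morphism (G, \<psi>) (F, \<phi>) \<beta>"
      "\<And>v. v \<in> verts G \<Longrightarrow> bij_betw (snd \<beta>) (out_arcs G v) (out_arcs F (fst \<beta> v))"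
      "\<And>v. v \<in> verts G \<Longrightarrow> bij_betw (snd \<beta>) (in_arcs G v) (in_arcs F (fst \<beta> v))"
    using over_isoE[OF over_iso_sym[OF iso] wfG wfF] by metis
  have "bij_betw (snd \<psi>) (out_arcs G v) (out_arcs E (fst \<psi> v))"
       "bij_betw (snd \<psi>) (in_arcs G v) (in_arcs E (fst \<psi> v))" if v: "v \<in> verts G" for v
  proof -
    have w: "fst \<beta> v \<in> verts F" "fst \<psi> v = fst \<phi> (fst \<beta> v)"
      using \<beta>(1) v by (auto simp: graph_hom_def map_eq_on_def map_comp_graph_def)
    have eq: "snd \<psi> e = (snd \<phi> \<circ> snd \<beta>) e" if "e \<in> arcs G" for e
      using \<beta>(1) that by (auto simp: map_eq_on_def map_comp_graph_def)
    have "bij_betw (snd \<phi> \<circ> snd \<beta>) (out_arcs G v) (out_arcs E (fst \<psi> v))"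
      using bij_betw_trans[OF \<beta>(2)[OF v]] cov w by auto
    then show "bij_betw (snd \<psi>) (out_arcs G v) (out_arcs E (fst \<psi> v))"
      by (rule bij_betw_cong[THEN iffD1, rotated]) (simp add: eq out_arcs_def)
    have "bij_betw (snd \<phi> \<circ> snd \<beta>) (in_arcs G v) (in_arcs E (fst \<psi> v))"
      using bij_betw_trans[OF \<beta>(3)[OF v]] cov w by auto
    then show "bij_betw (snd \<psi>) (in_arcs G v) (in_arcs E (fst \<psi> v))"
      by (rule bij_betw_cong[THEN iffD1, rotated]) (simp add: eq in_arcs_def)
  qed
  then show ?thesis
    using over_iso_connected[OF iso wfG] over_iso_hom[OF iso wfG] cov by (auto simp: XY)
qed

lemma ex1_transfer:
  assumes "bij_betw b A B" "\<And>x. x \<in> A \<Longrightarrow> P x \<longleftrightarrow> Q (b x)" "\<exists>!y. y \<in> B \<and> Q y"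
  shows "\<exists>!x. x \<in> A \<and> P x"
proof -
  from assms(3) obtain y where y: "y \<in> B" "Q y" "\<And>z. z \<in> B \<Longrightarrow> Q z \<Longrightarrow> z = y" by blast
  from y(1) assms(1) obtain x where x: "x \<in> A" "b x = y" by (auto simp: bij_betw_def)
  show ?thesis
  proof (rule ex1I[of _ x])
    show "x \<in> A \<and> P x" using x y(2) assms(2)[OF x(1)] by simp
    fix z assume z: "z \<in> A \<and> P z"
    then have "b z \<in> B" "Q (b z)" using assms(1,2) by (auto simp: bij_betw_def)
    then have "b z = b x" using y(3) x(2) by simp
    then show "z = x" using z x(1) assms(1) by (auto simp: bij_betw_def dest: inj_onD)
  qed
qed

lemma over_iso_representation_graph:
  assumes "over_iso X Y" "wf_digraph (fst Y)" "representation_graph E C D X"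
  shows "representation_graph E C D Y"
proof -
  obtain F \<phi> G \<psi> where XY: "X = (F, \<phi>)" "Y = (G, \<psi>)" by (cases X; cases Y)
  have iso: "over_iso (F, \<phi>) (G, \<psi>)" and wfG: "wf_digraph G"
    and rep: "representation_graph E C D (F, \<phi>)"
    using assms by (auto simp: XY)
  have wfF: "wf_digraph F" using rep by (auto intro: connected_graphD)
  obtain \<beta> where \<beta>: "over_morphism (G, \<psi>) (F, \<phi>) \<beta>"
      "\<And>v. v \<in> verts G \<Longrightarrow> bij_betw (snd \<beta>) (out_arcs G v) (out_arcs F (fst \<beta> v))"
      "\<And>v. v \<in> verts G \<Longrightarrow> bij_betw (snd \<beta>) (in_arcs G v) (in_arcs F (fst \<beta> v))"
    using over_isoE[OF over_iso_sym[OF iso] wfG wfF] by metis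
  have w: "fst \<beta> v \<in> verts F" "fst \<psi> v = fst \<phi> (fst \<beta> v)" if "v \<in> verts G" for v
    using \<beta>(1) that by (auto simp: graph_hom_def map_eq_on_def map_comp_graph_def)
  have eq: "snd \<psi> e = snd \<phi> (snd \<beta> e)" if "e \<in> arcs G" for e
    using \<beta>(1) that by (auto simp: map_eq_on_def map_comp_graph_def)
  have "\<exists>!f. f \<in> out_arcs G v \<and> snd \<psi> f \<in> X" if v: "v \<in> verts G" and "X \<in> C (fst \<psi> v)" for v X
    by (rule ex1_transfer[OF \<beta>(2)[OF v], where Q = "\<lambda>f. snd \<phi> f \<in> X"])
      (use rep w[OF v] that(2) in \<open>auto simp: eq out_arcs_def\<close>)
  moreover have "\<exists>!f. f \<in> in_arcs G v \<and> snd \<psi> f \<in> X" if v: "v \<in> verts G" and "X \<in> D (fst \<psi> v)" for v X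
    by (rule ex1_transfer[OF \<beta>(3)[OF v], where Q = "\<lambda>f. snd \<phi> f \<in> X"])
      (use rep w[OF v] that(2) in \<open>auto simp: eq in_arcs_def\<close>)
  ultimately show ?thesis
    using over_iso_connected[OF iso wfG] over_iso_hom[OF iso wfG] rep by (auto simp: XY)
qed

lemma locally_injective_std:
  assumes conn: "connected_graph F"
    and out: "\<And>v. v \<in> verts F \<Longrightarrow> inj_on (snd \<phi>) (out_arcs F v)"
    and "in": "\<And>v. v \<in> verts F \<Longrightarrow> inj_on (snd \<phi>) (in_arcs F v)"
  obtains Y :: "('a, 'b) std_over_graph" where "over_iso (F, \<phi>) Y" "wf_digraph (fst Y)"
proof -
  note wf = connected_graphD[OF conn]
  obtain v0 where v0: "v0 \<in> verts F" using wf(2) by blast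
  obtain P where P: "\<And>w. w \<in> verts F \<Longrightarrow> walk F v0 (P w) w"
    using conn v0 unfolding connected_graph_def by metis
  define h where "h w = map (map_sum (snd \<phi>) (snd \<phi>)) (P w)" for w
  define k where "k e = (h (tail F e), snd \<phi> e)" for e
  have h: "inj_on h (verts F)"
    using walk_lift_unique[OF wf(1) out "in" P P] by (auto simp: inj_on_def h_def)
  have k: "inj_on k (arcs F)"
  proof (rule inj_onI)
    fix e f assume ef: "e \<in> arcs F" "f \<in> arcs F" "k e = k f"
    then have t: "tail F e = tail F f" using h wf(3) by (auto simp: k_def dest: inj_onD)
    then have "e \<in> out_arcs F (tail F f)" "f \<in> out_arcs F (tail F f)"
      using ef by (auto simp: out_arcs_def)
    then show "e = f" using out[OF wf(3)[OF ef(2)]] ef(3) by (auto simp: k_def dest: inj_onD)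
  qed
  define h' where "h' = inv_into (verts F) h"
  define k' where "k' = inv_into (arcs F) k"
  have [simp]: "h' (h v) = v" if "v \<in> verts F" for v using h that by (simp add: h'_def)
  have [simp]: "k' (k e) = e" if "e \<in> arcs F" for e using k that by (simp add: k'_def)
  define G where "G = \<lparr> verts = h ` verts F, arcs = k ` arcs F,
     tail = h \<circ> tail F \<circ> k', head = h \<circ> head F \<circ> k' \<rparr>"
  define \<psi> where "\<psi> = (fst \<phi> \<circ> h', snd \<phi> \<circ> k')"
  have "wf_digraph G" by (auto simp: wf_digraph_def G_def wf)
  moreover have "over_iso (F, \<phi>) (G, \<psi>)"
    unfolding over_iso_def
    by (rule exI[of _ "(h, k)"], rule exI[of _ "(h', k')"])
      (auto simp: G_def \<psi>_def graph_hom_def map_eq_on_def map_comp_graph_def wf)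
  ultimately show thesis using that[of "(G, \<psi>)"] by simp
qed

theorem covering_std:
  assumes "covering E X"
  obtains Y :: "('a, 'b) std_over_graph" where "over_iso X Y" "covering E Y"
proof -
  obtain F \<phi> where X: "X = (F, \<phi>)" by (cases X)
  obtain Y :: "('a, 'b) std_over_graph" where "over_iso X Y" "wf_digraph (fst Y)"
    using locally_injective_std[of F \<phi>] assms X by (auto simp: bij_betw_def)
  then show thesis using that over_iso_covering assms by blast
qed

theorem universal_covering_all_types:
  fixes E :: "('a, 'b) pre_digraph"
  assumes "universal_covering E T" "covering E G"
  shows "\<exists>\<alpha>. over_morphism T G \<alpha>"
proof -
  obtain Y :: "('a, 'b) std_over_graph" where Y: "over_iso G Y" "covering E Y"
    by (rule covering_std[OF assms(2)])
  then obtain \<alpha> where "over_morphism T Y \<alpha>"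
    using assms(1) unfolding universal_covering_def by blast
  with over_iso_morphisms(2)[OF Y(1)] over_morphism_comp show ?thesis by blast
qed

lemma representation_graph_locally_injective:
  assumes bs: "bi_separated E C D" and rep: "representation_graph E C D (F, \<phi>)" and v: "v \<in> verts F"
  shows "inj_on (snd \<phi>) (out_arcs F v)" "inj_on (snd \<phi>) (in_arcs F v)"
proof -
  have hom: "graph_hom F E \<phi>" using rep by simp
  have vE: "fst \<phi> v \<in> verts E" using hom v by (simp add: graph_hom_def)
  show "inj_on (snd \<phi>) (out_arcs F v)"
  proof (rule inj_onI)
    fix e f assume e: "e \<in> out_arcs F v" and f: "f \<in> out_arcs F v" and eq: "snd \<phi> e = snd \<phi> f"
    have "snd \<phi> e \<in> out_arcs E (fst \<phi> v)" using e hom by (auto simp: out_arcs_def graph_hom_def)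
    moreover have "\<Union> (C (fst \<phi> v)) = out_arcs E (fst \<phi> v)"
      using bs vE by (simp add: bi_separated_def partition_on_def)
    ultimately obtain X where "X \<in> C (fst \<phi> v)" "snd \<phi> e \<in> X" by blast
    moreover from this have "\<exists>!f. f \<in> out_arcs F v \<and> snd \<phi> f \<in> X" using rep v by simp
    ultimately show "e = f" using e f eq by metis
  qed
  show "inj_on (snd \<phi>) (in_arcs F v)"
  proof (rule inj_onI)
    fix e f assume e: "e \<in> in_arcs F v" and f: "f \<in> in_arcs F v" and eq: "snd \<phi> e = snd \<phi> f"
    have "snd \<phi> e \<in> in_arcs E (fst \<phi> v)" using e hom by (auto simp: in_arcs_def graph_hom_def)
    moreover have "\<Union> (D (fst \<phi> v)) = in_arcs E (fst \<phi> v)"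
      using bs vE by (simp add: bi_separated_def partition_on_def)
    ultimately obtain X where "X \<in> D (fst \<phi> v)" "snd \<phi> e \<in> X" by blast
    moreover from this have "\<exists>!f. f \<in> in_arcs F v \<and> snd \<phi> f \<in> X" using rep v by simp
    ultimately show "e = f" using e f eq by metis
  qed
qed

theorem representation_graph_std:
  assumes "bi_separated E C D" "representation_graph E C D X"
  obtains Y where "over_iso X Y" "Y \<in> RG E C D"
proof -
  obtain F \<phi> where X: "X = (F, \<phi>)" by (cases X)
  obtain Y :: "('a, 'b) std_over_graph" where "over_iso X Y" "wf_digraph (fst Y)"
    using locally_injective_std[of F \<phi>] representation_graph_locally_injective[OF assms(1)]
      assms(2) X by (metis representation_graph.simps)
  moreover from this have "Y \<in> RG E C D"
    using over_iso_representation_graph assms(2) unfolding RG_def by blast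
  ultimately show thesis using that by blast
qed

lemma in_component_morphism_aux:
  assumes comp: "\<C> \<in> RG_components E C D"
    and "X \<in> RG E C D" "Y \<in> RG E C D" "over_morphism X Y \<alpha>"
  shows "X \<in> \<C> \<longleftrightarrow> Y \<in> \<C>"
proof -
  let ?r = "RG_arrows E C D \<union> (RG_arrows E C D)\<inverse>"
  obtain Z where Z: "\<C> = ?r\<^sup>* `` {Z}"
    using comp by (auto simp: RG_components_def elim: quotientE)
  have "(X, Y) \<in> ?r" "(Y, X) \<in> ?r" using assms(2-) unfolding RG_arrows_def by blast+
  then show ?thesis unfolding Z by (auto intro: rtrancl_into_rtrancl)
qed

lemma RG_component_subset:
  assumes "\<C> \<in> RG_components E C D" "Z \<in> \<C>"
  shows "Z \<in> RG E C D"
proof -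
  let ?r = "RG_arrows E C D \<union> (RG_arrows E C D)\<inverse>"
  obtain W where W: "W \<in> RG E C D" "\<C> = ?r\<^sup>* `` {W}"
    using assms(1) unfolding RG_components_def by (rule quotientE)
  have "(W, Z) \<in> ?r\<^sup>*" using assms(2) W(2) by simp
  then show ?thesis
  proof (cases rule: rtranclE)
    case base
    then show ?thesis using W(1) by simp
  next
    case (step Y)
    from step(2) show ?thesis unfolding RG_arrows_def by blast
  qed
qed

theorem in_component_morphism:
  assumes bs: "bi_separated E C D" and comp: "\<C> \<in> RG_components E C D"
    and X: "representation_graph E C D X" and Y: "representation_graph E C D Y"
    and \<alpha>: "over_morphism X Y \<alpha>"
  shows "in_component E C D \<C> X \<longleftrightarrow> in_component E C D \<C> Y"
proof -
  note rg = RG_component_subset[OF comp]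
  obtain X' where X': "over_iso X X'" "X' \<in> RG E C D" by (rule representation_graph_std[OF bs X])
  obtain Y' where Y': "over_iso Y Y'" "Y' \<in> RG E C D" by (rule representation_graph_std[OF bs Y])
  have "\<exists>\<beta>. over_morphism X' Y' \<beta>"
    using over_iso_morphisms[OF X'(1)] over_iso_morphisms[OF Y'(1)] \<alpha>
    by (meson over_morphism_comp)
  then have XY: "X' \<in> \<C> \<longleftrightarrow> Y' \<in> \<C>"
    using in_component_morphism_aux[OF comp X'(2) Y'(2)] by blast
  have "in_component E C D \<C> X \<longleftrightarrow> X' \<in> \<C>"
  proof
    assume "in_component E C D \<C> X"
    then obtain Z where Z: "Z \<in> \<C>" "over_iso X Z" unfolding in_component_def by blast
    obtain \<beta> where "over_morphism Z X' \<beta>"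
      using over_iso_morphisms[OF Z(2)] over_iso_morphisms[OF X'(1)] by (meson over_morphism_comp)
    then show "X' \<in> \<C>" using in_component_morphism_aux[OF comp rg[OF Z(1)] X'(2)] Z(1) by blast
  next
    assume "X' \<in> \<C>"
    then show "in_component E C D \<C> X" using X X'(1) unfolding in_component_def by blast
  qed
  moreover have "in_component E C D \<C> Y \<longleftrightarrow> Y' \<in> \<C>"
  proof
    assume "in_component E C D \<C> Y"
    then obtain Z where Z: "Z \<in> \<C>" "over_iso Y Z" unfolding in_component_def by blast
    obtain \<beta> where "over_morphism Z Y' \<beta>"
      using over_iso_morphisms[OF Z(2)] over_iso_morphisms[OF Y'(1)] by (meson over_morphism_comp)
    then show "Y' \<in> \<C>" using in_component_morphism_aux[OF comp rg[OF Z(1)] Y'(2)] Z(1) by blast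
  next
    assume "Y' \<in> \<C>"
    then show "in_component E C D \<C> Y" using Y Y'(1) unfolding in_component_def by blast
  qed
  ultimately show ?thesis using XY by simp
qed

theorem in_component_ex1:
  assumes bs: "bi_separated E C D" and X: "representation_graph E C D X"
  shows "\<exists>!\<C>. \<C> \<in> RG_components E C D \<and> in_component E C D \<C> X"
proof -
  let ?r = "RG_arrows E C D \<union> (RG_arrows E C D)\<inverse>"
  have eqv: "equiv UNIV (?r\<^sup>*)"
    by (intro equivI refl_rtrancl sym_rtrancl trans_rtrancl) (auto simp: sym_def)
  obtain X' where X': "over_iso X X'" "X' \<in> RG E C D" by (rule representation_graph_std[OF bs X])
  have rep': "representation_graph E C D X'" using X'(2) by (simp add: RG_def)
  obtain \<alpha> where \<alpha>: "over_morphism X X' \<alpha>" using over_iso_morphisms[OF X'(1)] by blast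
  have id: "over_iso X' X'"
    unfolding over_iso_def
    by (rule exI[of _ "(id, id)"], rule exI[of _ "(id, id)"])
      (cases X', auto simp: graph_hom_def map_eq_on_def map_comp_graph_def)
  have iff: "in_component E C D \<C> X \<longleftrightarrow> X' \<in> \<C>" if comp: "\<C> \<in> RG_components E C D" for \<C>
  proof
    assume "in_component E C D \<C> X"
    then have "in_component E C D \<C> X'" using in_component_morphism[OF bs comp X rep' \<alpha>] by simp
    then obtain Z where Z: "Z \<in> \<C>" "over_iso X' Z" unfolding in_component_def by blast
    have "Z \<in> RG E C D" by (rule RG_component_subset[OF comp Z(1)])
    then show "X' \<in> \<C>"
      using in_component_morphism_aux[OF comp X'(2)] Z over_iso_morphisms(1)[OF Z(2)] by blast
  next
    assume "X' \<in> \<C>"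
    then show "in_component E C D \<C> X" using X X'(1) unfolding in_component_def by blast
  qed
  show ?thesis
  proof (rule ex1I[of _ "?r\<^sup>* `` {X'}"])
    have comp: "?r\<^sup>* `` {X'} \<in> RG_components E C D"
      unfolding RG_components_def using X'(2) by (rule quotientI)
    with iff[OF comp] show "?r\<^sup>* `` {X'} \<in> RG_components E C D \<and> in_component E C D (?r\<^sup>* `` {X'}) X"
      by auto
    fix \<C> assume "\<C> \<in> RG_components E C D \<and> in_component E C D \<C> X"
    then have "\<C> \<in> RG_components E C D" "X' \<in> \<C>" using iff by auto
    then obtain Z where "\<C> = ?r\<^sup>* `` {Z}" "(Z, X') \<in> ?r\<^sup>*"
      by (auto simp: RG_components_def elim: quotientE)
    then show "\<C> = ?r\<^sup>* `` {X'}" using equiv_class_eq[OF eqv] by metis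
  qed
qed

text \<open>The quotient by \<open>walk_equiv\<close> is well defined.\<close>

lemma walk_equiv_step:
  assumes wf: "wf_digraph F" and bs: "bi_separated E C D"
    and rep: "representation_graph E C D (F, \<phi>)"
    and uv: "(u, v) \<in> walk_equiv (F, \<phi>)"
    and e: "walk F u [e] u'" and e': "walk F v [e'] v'"
    and eq: "map_sum (snd \<phi>) (snd \<phi>) e = map_sum (snd \<phi>) (snd \<phi>) e'"
  shows "(u', v') \<in> walk_equiv (F, \<phi>)"
proof -
  have lift: "p = q \<and> v = w" if "walk F u p v" "walk F u q w"
      "map (map_sum (snd \<phi>) (snd \<phi>)) p = map (map_sum (snd \<phi>) (snd \<phi>)) q" for u p q v w
    by (rule walk_lift_unique[OF wf _ _ that])
      (simp_all only: representation_graph_locally_injective[OF bs rep])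
  have end_image: "fst \<phi> w = head (double_graph E) (map_sum (snd \<phi>) (snd \<phi>) d)"
    if "walk F u [d] w" for u d w
    using that rep by (cases d) (auto simp: walk_Cons[OF wf] graph_hom_def)
  have sub: "walk_map \<phi> ` walks_from F u' \<subseteq> walk_map \<phi> ` walks_from F v'"
    if uv: "(u, v) \<in> walk_equiv (F, \<phi>)"
      and e: "walk F u [e] u'" and e': "walk F v [e'] v'"
      and eq: "map_sum (snd \<phi>) (snd \<phi>) e = map_sum (snd \<phi>) (snd \<phi>) e'"
    for u v e e' u' v'
  proof
    fix x assume "x \<in> walk_map \<phi> ` walks_from F u'"
    then obtain p w where p: "walk F u' p w" "x = walk_map \<phi> (u', p)" by (auto simp: walks_from_def)
    have "walk F u (e # p) w" using e p by (auto simp: walk_Cons[OF wf])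
    then have "walk_map \<phi> (u, e # p) \<in> walk_map \<phi> ` walks_from F u" by (auto simp: walks_from_def)
    moreover have "walk_map \<phi> ` walks_from F u = walk_map \<phi> ` walks_from F v" using uv by simp
    ultimately have "walk_map \<phi> (u, e # p) \<in> walk_map \<phi> ` walks_from F v" by (simp only:)
    then obtain q w' where q: "walk F v q w'"
        "map (map_sum (snd \<phi>) (snd \<phi>)) (e # p) = map (map_sum (snd \<phi>) (snd \<phi>)) q"
      by (auto simp: walks_from_def walk_map_def)
    then obtain e'' q' where q': "q = e'' # q'" by (cases q) auto
    have e'': "walk F v [e''] (head (double_graph F) e'')"
    proof -
      have "walk F (head (double_graph F) e'') q' w'" using q(1) q' by (simp add: walk_Cons[OF wf])
      then have "head (double_graph F) e'' \<in> verts F" by (simp add: pre_digraph.awalk_def)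
      then show ?thesis using q(1) q' by (simp add: walk_Cons[OF wf])
    qed
    have "[e'] = [e''] \<and> v' = head (double_graph F) e''"
      using lift[OF e' e''] q(2) q' eq by simp
    then have q'': "walk F v' q' w'" using q(1) q' by (simp add: walk_Cons[OF wf])
    have "fst \<phi> u' = fst \<phi> v'"
      using end_image[OF e] end_image[OF e'] eq by simp
    then have "x = walk_map \<phi> (v', q')" using p(2) q(2) q' by (simp add: walk_map_def)
    then show "x \<in> walk_map \<phi> ` walks_from F v'" using q'' by (auto simp: walks_from_def)
  qed
  have sym: "(v, u) \<in> walk_equiv (F, \<phi>)" using uv by auto
  have "u' \<in> verts F" "v' \<in> verts F" using e e' by (auto simp: walk_Cons[OF wf])
  with sub[OF uv e e' eq] sub[OF sym e' e eq[symmetric]] show ?thesis by auto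
qed

theorem quotient_walk_equiv_simps:
  fixes F :: "('v, 'e) pre_digraph" and \<phi> :: "('v, 'e, 'a, 'b) graph_map"
  defines "R \<equiv> walk_equiv (F, \<phi>)" and "A \<equiv> arc_equiv (F, \<phi>) (walk_equiv (F, \<phi>))"
    and "Q \<equiv> quotient_over_graph (F, \<phi>) (walk_equiv (F, \<phi>))"
  assumes bs: "bi_separated E C D" and rep: "representation_graph E C D (F, \<phi>)"
  shows "v \<in> verts F \<Longrightarrow> fst (snd Q) (R `` {v}) = fst \<phi> v"
    and "e \<in> arcs F \<Longrightarrow> snd (snd Q) (A `` {e}) = snd \<phi> e"
    and "e \<in> arcs F \<Longrightarrow> tail (fst Q) (A `` {e}) = R `` {tail F e}"
    and "e \<in> arcs F \<Longrightarrow> head (fst Q) (A `` {e}) = R `` {head F e}"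
proof -
  have wf: "wf_digraph F" using rep by (auto intro: connected_graphD)
  note tail_head = wf_digraph.tail_in_verts[OF wf] wf_digraph.head_in_verts[OF wf]
  have eqv: "equiv (verts F) R" by (auto simp: R_def intro!: equivI refl_onI symI transI)
  have \<phi>R: "fst \<phi> u = fst \<phi> v" if "(u, v) \<in> R" for u v
  proof -
    have "walk F u [] u" using that by (simp add: R_def)
    then have "walk_map \<phi> (u, []) \<in> walk_map \<phi> ` walks_from F u"
      unfolding walks_from_def by blast
    moreover have "walk_map \<phi> ` walks_from F u = walk_map \<phi> ` walks_from F v"
      using that by (simp add: R_def)
    ultimately have "walk_map \<phi> (u, []) \<in> walk_map \<phi> ` walks_from F v" by (simp only:)
    then show ?thesis by (auto simp: walks_from_def walk_map_def)
  qed
  show "fst (snd Q) (R `` {v}) = fst \<phi> v" if "v \<in> verts F"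
  proof -
    have "fst \<phi> ` (R `` {v}) = {fst \<phi> v}"
    proof (intro equalityI subsetI)
      fix x assume "x \<in> fst \<phi> ` (R `` {v})"
      then obtain u where "(v, u) \<in> R" "x = fst \<phi> u" by blast
      then show "x \<in> {fst \<phi> v}" using \<phi>R by simp
    next
      fix x assume "x \<in> {fst \<phi> v}"
      then show "x \<in> fst \<phi> ` (R `` {v})" using equiv_class_self[OF eqv that] by simp
    qed
    then show ?thesis by (simp add: Q_def del: walk_equiv.simps flip: R_def)
  qed
  show "snd (snd Q) (A `` {e}) = snd \<phi> e" if "e \<in> arcs F"
  proof -
    have "snd \<phi> ` (A `` {e}) = {snd \<phi> e}"
      using that tail_head by (force simp: A_def)
    then show ?thesis by (simp add: Q_def del: walk_equiv.simps arc_equiv.simps flip: A_def)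
  qed
  have Aself: "e \<in> A `` {e}" if "e \<in> arcs F" for e using that tail_head by (auto simp: A_def)
  have Atail: "R `` {tail F f} = R `` {tail F e}" if "f \<in> A `` {e}" for e f
    using that by (intro equiv_class_eq[OF eqv]) (auto simp: A_def R_def)
  have Ahead: "R `` {head F f} = R `` {head F e}" if "f \<in> A `` {e}" for e f
  proof -
    have "(tail F e, tail F f) \<in> walk_equiv (F, \<phi>)" "e \<in> arcs F" "f \<in> arcs F" "snd \<phi> e = snd \<phi> f"
      using that by (auto simp: A_def)
    moreover from this have w: "walk F (tail F e) [Inl e] (head F e)" "walk F (tail F f) [Inl f] (head F f)"
      by (auto simp: walk_Cons[OF wf] tail_head)
    ultimately have "(head F e, head F f) \<in> R"
      using walk_equiv_step[OF wf bs rep _ w] unfolding R_def by simp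
    then show ?thesis using equiv_class_eq[OF eqv] by metis
  qed
  show "tail (fst Q) (A `` {e}) = R `` {tail F e}" if "e \<in> arcs F"
  proof -
    have "(\<Union>f\<in>A `` {e}. R `` {tail F f}) = R `` {tail F e}" using Atail Aself[OF that] by blast
    then show ?thesis by (simp add: Q_def del: walk_equiv.simps arc_equiv.simps flip: A_def R_def)
  qed
  show "head (fst Q) (A `` {e}) = R `` {head F e}" if "e \<in> arcs F"
  proof -
    have "(\<Union>f\<in>A `` {e}. R `` {head F f}) = R `` {head F e}" using Ahead Aself[OF that] by blast
    then show ?thesis by (simp add: Q_def del: walk_equiv.simps arc_equiv.simps flip: A_def R_def)
  qed
qed

end

theory Submission
  imports Defs
begin

text \<open>A representation graph carries at each vertex \<open>u\<close> the set of images in \<open>E\<close> of the walks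
  starting at \<open>u\<close>; call this set the type of \<open>u\<close>. The whole argument rests on one invariant,
  the set of types that occur in a representation graph.

  A morphism \<open>\<alpha>\<close> of representation graphs is automatically a covering, since in source and target
  alike there is exactly one edge at each vertex over each block of \<open>C\<close> and \<open>D\<close>
  (\<open>over_morphism_covering\<close>). Hence walks lift along \<open>\<alpha>\<close>, so \<open>\<alpha>\<close> preserves types and, the target
  being connected, is onto; so the occurring types are the same on both sides
  (\<open>vertex_types_morphism\<close>), and therefore constant on a connected component of the category
  (\<open>vertex_types_in_component\<close>).

  On the other hand, dividing a representation graph \<open>T\<close> by equality of types gives a representation
  graph \<open>S\<close> with exactly one vertex of each occurring type. A representation graph \<open>X\<close> all of
  whose types occur in \<open>T\<close> has a morphism to \<open>S\<close> that sends each vertex to the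
  vertex of the same type; it is compatible with edges because the type of a vertex and the
  image of an edge leaving it determine the type at the other end of the edge
  (\<open>walk_images_step\<close>, \<open>quotient_attracts\<close>). By the invariant this applies to every \<open>X\<close> in the
  component of \<open>T\<close>, so \<open>S\<close> is attracting. The description of all objects follows: a morphism to \<open>S\<close>
  is a covering, and conversely a covering of \<open>S\<close> is a representation graph with a morphism to \<open>S\<close>,
  which keeps it in the component.\<close>

section \<open>Coverings and morphisms of representation graphs\<close>

lemma bi_separated_block:
  assumes bs: "bi_separated E C D" and hom: "graph_hom G E \<psi>" and w: "w \<in> verts G"
  shows "g \<in> out_arcs G w \<Longrightarrow> \<exists>X\<in>C (fst \<psi> w). snd \<psi> g \<in> X"
    and "g \<in> in_arcs G w \<Longrightarrow> \<exists>Y\<in>D (fst \<psi> w). snd \<psi> g \<in> Y"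
proof -
  have wE: "fst \<psi> w \<in> verts E" using hom w by (simp add: graph_hom_def)
  have C: "\<Union> (C (fst \<psi> w)) = out_arcs E (fst \<psi> w)" and D: "\<Union> (D (fst \<psi> w)) = in_arcs E (fst \<psi> w)"
    using bs wE by (simp_all add: bi_separated_def partition_on_def)
  show "\<exists>X\<in>C (fst \<psi> w). snd \<psi> g \<in> X" if "g \<in> out_arcs G w"
  proof -
    have "snd \<psi> g \<in> out_arcs E (fst \<psi> w)" using that hom by (auto simp: out_arcs_def graph_hom_def)
    then show ?thesis unfolding C[symmetric] by blast
  qed
  show "\<exists>Y\<in>D (fst \<psi> w). snd \<psi> g \<in> Y" if "g \<in> in_arcs G w"
  proof -
    have "snd \<psi> g \<in> in_arcs E (fst \<psi> w)" using that hom by (auto simp: in_arcs_def graph_hom_def)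
    then show ?thesis unfolding D[symmetric] by blast
  qed
qed

text \<open>Given an edge \<open>g\<close> at \<open>\<alpha> v\<close>, take the block containing its image in \<open>E\<close>. The edge at \<open>v\<close>
  over this block is mapped by \<open>\<alpha>\<close> to an edge at \<open>\<alpha> v\<close> over the same block, that is, to \<open>g\<close>.\<close>

lemma over_morphism_covering:
  assumes bs: "bi_separated E C D"
    and F: "representation_graph E C D (F, \<phi>)" and G: "representation_graph E C D (G, \<psi>)"
    and \<alpha>: "over_morphism (F, \<phi>) (G, \<psi>) \<alpha>"
  shows "covering G (F, \<alpha>)"
proof -
  have hom: "graph_hom F G \<alpha>" and homG: "graph_hom G E \<psi>" using \<alpha> G by auto
  have \<alpha>v: "fst \<alpha> v \<in> verts G" "fst \<psi> (fst \<alpha> v) = fst \<phi> v" if "v \<in> verts F" for v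
    using \<alpha> that by (auto simp: graph_hom_def map_eq_on_def map_comp_graph_def)
  have \<alpha>e: "snd \<psi> (snd \<alpha> e) = snd \<phi> e" if "e \<in> arcs F" for e
    using \<alpha> that by (auto simp: map_eq_on_def map_comp_graph_def)
  have "bij_betw (snd \<alpha>) (out_arcs F v) (out_arcs G (fst \<alpha> v))" if v: "v \<in> verts F" for v
  proof -
    have maps: "snd \<alpha> f \<in> out_arcs G (fst \<alpha> v)" if "f \<in> out_arcs F v" for f
      using hom that by (auto simp: graph_hom_def out_arcs_def)
    have "inj_on (snd \<alpha>) (out_arcs F v)"
    proof (rule inj_onI)
      fix e f assume ef: "e \<in> out_arcs F v" "f \<in> out_arcs F v" "snd \<alpha> e = snd \<alpha> f"
      then have "snd \<phi> e = snd \<phi> f" using \<alpha>e[of e] \<alpha>e[of f] by simp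
      with ef show "e = f"
        by (intro inj_onD[OF representation_graph_locally_injective(1)[OF bs F v]])
    qed
    moreover have "g \<in> snd \<alpha> ` out_arcs F v" if g: "g \<in> out_arcs G (fst \<alpha> v)" for g
    proof -
      obtain X where X: "X \<in> C (fst \<phi> v)" "snd \<psi> g \<in> X"
        using bi_separated_block(1)[OF bs homG \<alpha>v(1)[OF v] g] \<alpha>v(2)[OF v] by auto
      then have "\<exists>!f. f \<in> out_arcs F v \<and> snd \<phi> f \<in> X" using F v X(1) by simp
      then obtain f where f: "f \<in> out_arcs F v" "snd \<phi> f \<in> X" by blast
      have "\<exists>!g. g \<in> out_arcs G (fst \<alpha> v) \<and> snd \<psi> g \<in> X" using G \<alpha>v[OF v] X(1) by auto
      moreover have "snd \<psi> (snd \<alpha> f) \<in> X" using f \<alpha>e by auto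
      ultimately have "snd \<alpha> f = g" using maps[OF f(1)] g X(2) by blast
      with f show ?thesis by blast
    qed
    ultimately show ?thesis using maps unfolding bij_betw_def by blast
  qed
  moreover have "bij_betw (snd \<alpha>) (in_arcs F v) (in_arcs G (fst \<alpha> v))" if v: "v \<in> verts F" for v
  proof -
    have maps: "snd \<alpha> f \<in> in_arcs G (fst \<alpha> v)" if "f \<in> in_arcs F v" for f
      using hom that by (auto simp: graph_hom_def in_arcs_def)
    have "inj_on (snd \<alpha>) (in_arcs F v)"
    proof (rule inj_onI)
      fix e f assume ef: "e \<in> in_arcs F v" "f \<in> in_arcs F v" "snd \<alpha> e = snd \<alpha> f"
      then have "snd \<phi> e = snd \<phi> f" using \<alpha>e[of e] \<alpha>e[of f] by simp
      with ef show "e = f"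
        by (intro inj_onD[OF representation_graph_locally_injective(2)[OF bs F v]])
    qed
    moreover have "g \<in> snd \<alpha> ` in_arcs F v" if g: "g \<in> in_arcs G (fst \<alpha> v)" for g
    proof -
      obtain Y where Y: "Y \<in> D (fst \<phi> v)" "snd \<psi> g \<in> Y"
        using bi_separated_block(2)[OF bs homG \<alpha>v(1)[OF v] g] \<alpha>v(2)[OF v] by auto
      then have "\<exists>!f. f \<in> in_arcs F v \<and> snd \<phi> f \<in> Y" using F v Y(1) by simp
      then obtain f where f: "f \<in> in_arcs F v" "snd \<phi> f \<in> Y" by blast
      have "\<exists>!g. g \<in> in_arcs G (fst \<alpha> v) \<and> snd \<psi> g \<in> Y" using G \<alpha>v[OF v] Y(1) by auto
      moreover have "snd \<psi> (snd \<alpha> f) \<in> Y" using f \<alpha>e by auto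
      ultimately have "snd \<alpha> f = g" using maps[OF f(1)] g Y(2) by blast
      with f show ?thesis by blast
    qed
    ultimately show ?thesis using maps unfolding bij_betw_def by blast
  qed
  ultimately show ?thesis using F hom by auto
qed

text \<open>The map to \<open>E\<close> is left as any \<open>\<eta>\<close> that agrees with the composite on \<open>G\<close>, since maps
  of graphs matter only there.\<close>

lemma covering_representation_graph:
  assumes cov: "covering F (G, \<alpha>)" and F: "representation_graph E C D (F, \<phi>)"
    and \<eta>: "map_eq_on G \<eta> (\<phi> \<circ>\<^sub>g \<alpha>)"
  shows "representation_graph E C D (G, \<eta>)" and "over_morphism (G, \<eta>) (F, \<phi>) \<alpha>"
proof -
  have hom: "graph_hom G F \<alpha>" and homF: "graph_hom F E \<phi>" and connG: "connected_graph G"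
    using cov F by auto
  have \<eta>v: "fst \<eta> v = fst \<phi> (fst \<alpha> v)" "fst \<alpha> v \<in> verts F" if "v \<in> verts G" for v
    using \<eta> hom that by (auto simp: map_eq_on_def map_comp_graph_def graph_hom_def)
  have \<eta>e: "snd \<eta> e = snd \<phi> (snd \<alpha> e)" if "e \<in> arcs G" for e
    using \<eta> that by (auto simp: map_eq_on_def map_comp_graph_def)
  have "graph_hom G E \<eta>"
    using hom homF connected_graphD(3,4)[OF connG] by (auto simp: graph_hom_def \<eta>v \<eta>e)
  moreover have "\<exists>!f. f \<in> out_arcs G w \<and> snd \<eta> f \<in> X"
    if w: "w \<in> verts G" and X: "X \<in> C (fst \<eta> w)" for w X
  proof (rule ex1_transfer)
    show "bij_betw (snd \<alpha>) (out_arcs G w) (out_arcs F (fst \<alpha> w))" using cov w by simp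
    show "snd \<eta> f \<in> X \<longleftrightarrow> snd \<phi> (snd \<alpha> f) \<in> X" if "f \<in> out_arcs G w" for f
      using that \<eta>e by simp
    show "\<exists>!f. f \<in> out_arcs F (fst \<alpha> w) \<and> snd \<phi> f \<in> X" using F X \<eta>v[OF w] by simp
  qed
  moreover have "\<exists>!f. f \<in> in_arcs G w \<and> snd \<eta> f \<in> Y"
    if w: "w \<in> verts G" and Y: "Y \<in> D (fst \<eta> w)" for w Y
  proof (rule ex1_transfer)
    show "bij_betw (snd \<alpha>) (in_arcs G w) (in_arcs F (fst \<alpha> w))" using cov w by simp
    show "snd \<eta> f \<in> Y \<longleftrightarrow> snd \<phi> (snd \<alpha> f) \<in> Y" if "f \<in> in_arcs G w" for f
      using that \<eta>e by simp
    show "\<exists>!f. f \<in> in_arcs F (fst \<alpha> w) \<and> snd \<phi> f \<in> Y" using F Y \<eta>v[OF w] by simp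
  qed
  ultimately show "representation_graph E C D (G, \<eta>)" using connG by simp
  show "over_morphism (G, \<eta>) (F, \<phi>) \<alpha>"
    using hom \<eta> by (simp add: map_eq_on_def)
qed

lemma covering_walk_lift:
  assumes cov: "covering G (F, \<alpha>)" and wfG: "wf_digraph G"
    and "u \<in> verts F" "walk G (fst \<alpha> u) p w"
  shows "\<exists>q v. walk F u q v \<and> map (map_sum (snd \<alpha>) (snd \<alpha>)) q = p \<and> fst \<alpha> v = w"
  using assms(3,4)
proof (induction p arbitrary: u)
  case Nil
  then show ?case by (intro exI[of _ "[]"] exI[of _ u]) simp
next
  case (Cons d p)
  have conn: "connected_graph F" and hom: "graph_hom F G \<alpha>" using cov by auto
  note wf = connected_graphD[OF conn]
  obtain e where e: "e \<in> arcs F <+> arcs F" "tail (double_graph F) e = u"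
    "map_sum (snd \<alpha>) (snd \<alpha>) e = d"
  proof (cases d)
    case (Inl g)
    then have "g \<in> out_arcs G (fst \<alpha> u)" using Cons.prems by (auto simp: walk_Cons[OF wfG] out_arcs_def)
    moreover have "snd \<alpha> ` out_arcs F u = out_arcs G (fst \<alpha> u)"
      using cov Cons.prems(1) by (simp add: bij_betw_def)
    ultimately have "g \<in> snd \<alpha> ` out_arcs F u" by (simp only:)
    then obtain f where "f \<in> out_arcs F u" "snd \<alpha> f = g" by blast
    then show ?thesis using that[of "Inl f"] Inl by auto
  next
    case (Inr g)
    then have "g \<in> in_arcs G (fst \<alpha> u)" using Cons.prems by (auto simp: walk_Cons[OF wfG] in_arcs_def)
    moreover have "snd \<alpha> ` in_arcs F u = in_arcs G (fst \<alpha> u)"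
      using cov Cons.prems(1) by (simp add: bij_betw_def)
    ultimately have "g \<in> snd \<alpha> ` in_arcs F u" by (simp only:)
    then obtain f where "f \<in> in_arcs F u" "snd \<alpha> f = g" by blast
    then show ?thesis using that[of "Inr f"] Inr by auto
  qed
  let ?u = "head (double_graph F) e"
  have "?u \<in> verts F" "fst \<alpha> ?u = head (double_graph G) d"
    using e hom wf by (auto simp: graph_hom_def)
  then obtain q v where "walk F ?u q v" "map (map_sum (snd \<alpha>) (snd \<alpha>)) q = p" "fst \<alpha> v = w"
    using Cons.IH[of ?u] Cons.prems(2) by (auto simp: walk_Cons[OF wfG])
  with e show ?case
    by (intro exI[of _ "e # q"] exI[of _ v]) (auto simp: walk_Cons[OF wf(1)])
qed

section \<open>Types of vertices\<close>

text \<open>The type of a vertex. Types live over \<open>E\<close>, so vertices of different representation graphs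
  can be compared by their types.\<close>

definition walk_images :: "('v, 'e, 'a, 'b) over_graph \<Rightarrow> 'v \<Rightarrow> ('a \<times> ('b + 'b) list) set" where
  "walk_images X u = walk_map (snd X) ` walks_from (fst X) u"

definition vertex_types :: "('v, 'e, 'a, 'b) over_graph \<Rightarrow> ('a \<times> ('b + 'b) list) set set" where
  "vertex_types X = walk_images X ` verts (fst X)"

lemma mem_walk_images:
  "(x, p) \<in> walk_images (F, \<phi>) u \<longleftrightarrow>
     x = fst \<phi> u \<and> (\<exists>q v. walk F u q v \<and> p = map (map_sum (snd \<phi>) (snd \<phi>)) q)"
  by (auto simp: walk_images_def walks_from_def walk_map_def)

lemma walk_images_base:
  assumes "walk_images (F, \<phi>) u = walk_images (G, \<psi>) v" "u \<in> verts F"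
  shows "fst \<phi> u = fst \<psi> v"
proof -
  have "(fst \<phi> u, []) \<in> walk_images (F, \<phi>) u"
    using assms(2) by (auto simp: mem_walk_images intro!: exI[of _ "[]"])
  then show ?thesis unfolding assms(1) by (simp add: mem_walk_images)
qed

lemma walk_single:
  assumes "wf_digraph F"
  shows "walk F u [e] v \<longleftrightarrow> e \<in> arcs F <+> arcs F \<and>
    u = tail (double_graph F) e \<and> v = head (double_graph F) e"
  using assms by (auto simp: walk_Cons wf_digraph_def)

text \<open>Equal types at two vertices allow an edge leaving one of them to be copied to the other.\<close>

lemma walk_images_edge:
  assumes eq: "walk_images (F, \<phi>) u = walk_images (G, \<psi>) v" and e: "walk F u [e] u'"
  shows "\<exists>d v'. walk G v [d] v' \<and> map_sum (snd \<psi>) (snd \<psi>) d = map_sum (snd \<phi>) (snd \<phi>) e"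
proof -
  have "(fst \<phi> u, [map_sum (snd \<phi>) (snd \<phi>) e]) \<in> walk_images (F, \<phi>) u"
    using e by (auto simp: mem_walk_images intro!: exI[of _ "[e]"])
  then obtain q v' where "walk G v q v'"
      "[map_sum (snd \<phi>) (snd \<phi>) e] = map (map_sum (snd \<psi>) (snd \<psi>)) q"
    unfolding eq unfolding mem_walk_images by metis
  then show ?thesis by (intro exI[of _ "hd q"] exI[of _ v']) (cases q; auto)
qed

lemma walk_images_out_arc:
  assumes wfF: "wf_digraph F" and wfG: "wf_digraph G"
    and eq: "walk_images (F, \<phi>) (tail F e) = walk_images (G, \<psi>) v" and e: "e \<in> arcs F"
  obtains g where "g \<in> out_arcs G v" "snd \<psi> g = snd \<phi> e"
proof -
  have w: "walk F (tail F e) [Inl e] (head F e)" using e by (auto simp: walk_single[OF wfF])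
  obtain d v' where "walk G v [d] v'" "map_sum (snd \<psi>) (snd \<psi>) d = Inl (snd \<phi> e)"
    using walk_images_edge[OF eq w] by auto
  then show thesis using that by (cases d) (auto simp: walk_Cons[OF wfG])
qed

lemma walk_images_in_arc:
  assumes wfF: "wf_digraph F" and wfG: "wf_digraph G"
    and eq: "walk_images (F, \<phi>) (head F e) = walk_images (G, \<psi>) v" and e: "e \<in> arcs F"
  obtains g where "g \<in> in_arcs G v" "snd \<psi> g = snd \<phi> e"
proof -
  have w: "walk F (head F e) [Inr e] (tail F e)" using e by (auto simp: walk_single[OF wfF])
  obtain d v' where "walk G v [d] v'" "map_sum (snd \<psi>) (snd \<psi>) d = Inr (snd \<phi> e)"
    using walk_images_edge[OF eq w] by auto
  then show thesis using that by (cases d) (auto simp: walk_Cons[OF wfG])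
qed

text \<open>The walks from the end of an edge \<open>e\<close> are the continuations of the walk \<open>e\<close>. An
  image of the form \<open>d # p\<close> can only come from a walk that begins with \<open>e\<close> itself, because a
  representation graph is locally injective over \<open>E\<close>. The right hand side mentions only the type
  of the starting vertex and the image \<open>d\<close> of \<open>e\<close>.\<close>

lemma walk_images_step:
  assumes bs: "bi_separated E C D" and rep: "representation_graph E C D (F, \<phi>)"
    and e: "walk F u [e] u'" and d: "d = map_sum (snd \<phi>) (snd \<phi>) e"
  shows "walk_images (F, \<phi>) u' =
    {(head (double_graph E) d, p) | p. (tail (double_graph E) d, d # p) \<in> walk_images (F, \<phi>) u}"
proof -
  have hom: "graph_hom F E \<phi>" and wf: "wf_digraph F" using rep by (auto intro: connected_graphD)
  have ends: "tail (double_graph E) d = fst \<phi> u" "head (double_graph E) d = fst \<phi> u'"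
    using e hom by (cases e; auto simp: walk_Cons[OF wf] graph_hom_def d)+
  have "(fst \<phi> u', p) \<in> walk_images (F, \<phi>) u' \<longleftrightarrow> (fst \<phi> u, d # p) \<in> walk_images (F, \<phi>) u" for p
  proof
    assume "(fst \<phi> u', p) \<in> walk_images (F, \<phi>) u'"
    then obtain q v where "walk F u' q v" "p = map (map_sum (snd \<phi>) (snd \<phi>)) q"
      by (auto simp: mem_walk_images)
    then have "walk F u (e # q) v" "d # p = map (map_sum (snd \<phi>) (snd \<phi>)) (e # q)"
      using e d by (auto simp: walk_Cons[OF wf])
    then show "(fst \<phi> u, d # p) \<in> walk_images (F, \<phi>) u" unfolding mem_walk_images by metis
  next
    assume "(fst \<phi> u, d # p) \<in> walk_images (F, \<phi>) u"
    then obtain q v where q: "walk F u q v" "d # p = map (map_sum (snd \<phi>) (snd \<phi>)) q"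
      by (auto simp: mem_walk_images)
    then obtain e' q' where q': "q = e' # q'" by (cases q) auto
    have w: "walk F (head (double_graph F) e') q' v" using q(1) q' by (simp add: walk_Cons[OF wf])
    then have "head (double_graph F) e' \<in> verts F" by (simp add: pre_digraph.awalk_def)
    then have "walk F u [e'] (head (double_graph F) e')"
      using q(1) q' by (simp add: walk_Cons[OF wf] walk_single[OF wf])
    then have "[e] = [e'] \<and> u' = head (double_graph F) e'"
      using walk_lift_unique[OF wf representation_graph_locally_injective[OF bs rep] e] q(2) q' d
      by simp
    with w q(2) q' show "(fst \<phi> u', p) \<in> walk_images (F, \<phi>) u'" by (auto simp: mem_walk_images)
  qed
  moreover have "x = fst \<phi> u'" if "(x, p) \<in> walk_images (F, \<phi>) u'" for x p
    using that by (simp add: mem_walk_images)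
  ultimately show ?thesis unfolding ends by auto
qed

lemma walk_images_step_eq:
  assumes bs: "bi_separated E C D"
    and F: "representation_graph E C D (F, \<phi>)" and G: "representation_graph E C D (G, \<psi>)"
    and eq: "walk_images (F, \<phi>) u = walk_images (G, \<psi>) v"
    and e: "walk F u [e] u'" and d: "walk G v [d] v'"
    and im: "map_sum (snd \<phi>) (snd \<phi>) e = map_sum (snd \<psi>) (snd \<psi>) d"
  shows "walk_images (F, \<phi>) u' = walk_images (G, \<psi>) v'"
  using walk_images_step[OF bs F e refl] walk_images_step[OF bs G d refl] by (simp only: eq im)

section \<open>The types occurring in a component\<close>

text \<open>Here \<open>\<alpha>\<close> is both a covering and a map over \<open>E\<close>: a walk from \<open>\<alpha> u\<close> lifts to one from \<open>u\<close>, and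
  being over \<open>E\<close> the two have the same image there.\<close>

lemma walk_images_morphism:
  assumes cov: "covering G (F, \<alpha>)" and wfG: "wf_digraph G"
    and \<alpha>: "over_morphism (F, \<phi>) (G, \<psi>) \<alpha>" and u: "u \<in> verts F"
  shows "walk_images (G, \<psi>) (fst \<alpha> u) = walk_images (F, \<phi>) u"
proof -
  have wf: "wf_digraph F" using cov by (auto intro: connected_graphD)
  have eq: "fst \<psi> (fst \<alpha> v) = fst \<phi> v" if "v \<in> verts F" for v
    using \<alpha> that by (auto simp: map_eq_on_def map_comp_graph_def)
  have eqp: "map (map_sum (snd \<psi>) (snd \<psi>)) (map (map_sum (snd \<alpha>) (snd \<alpha>)) q)
      = map (map_sum (snd \<phi>) (snd \<phi>)) q" if "walk F v q w" for q v w
    using that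
  proof (induction q arbitrary: v)
    case (Cons e q)
    then have "e \<in> arcs F <+> arcs F" by (simp add: walk_Cons[OF wf])
    then have "map_sum (snd \<psi>) (snd \<psi>) (map_sum (snd \<alpha>) (snd \<alpha>) e) = map_sum (snd \<phi>) (snd \<phi>) e"
      using \<alpha> by (auto simp: map_eq_on_def map_comp_graph_def)
    with Cons show ?case by (auto simp: walk_Cons[OF wf])
  qed simp
  have "(x, p) \<in> walk_images (G, \<psi>) (fst \<alpha> u) \<longleftrightarrow> (x, p) \<in> walk_images (F, \<phi>) u" for x p
  proof
    assume "(x, p) \<in> walk_images (G, \<psi>) (fst \<alpha> u)"
    then obtain r w where r: "x = fst \<phi> u" "walk G (fst \<alpha> u) r w"
        "p = map (map_sum (snd \<psi>) (snd \<psi>)) r"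
      using eq[OF u] by (auto simp: mem_walk_images)
    obtain q v where q: "walk F u q v" "map (map_sum (snd \<alpha>) (snd \<alpha>)) q = r"
      using covering_walk_lift[OF cov wfG u r(2)] by blast
    then have "p = map (map_sum (snd \<phi>) (snd \<phi>)) q" using eqp[OF q(1)] r(3) by simp
    with q(1) r(1) show "(x, p) \<in> walk_images (F, \<phi>) u" unfolding mem_walk_images by metis
  next
    assume "(x, p) \<in> walk_images (F, \<phi>) u"
    then obtain q v where q: "x = fst \<phi> u" "walk F u q v" "p = map (map_sum (snd \<phi>) (snd \<phi>)) q"
      by (auto simp: mem_walk_images)
    have "walk G (fst \<alpha> u) (map (map_sum (snd \<alpha>) (snd \<alpha>)) q) (fst \<alpha> v)"
      using walk_hom[OF wf wfG _ q(2)] \<alpha> by simp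
    then show "(x, p) \<in> walk_images (G, \<psi>) (fst \<alpha> u)"
      unfolding mem_walk_images using q eqp[OF q(2)] eq[OF u] by metis
  qed
  then show ?thesis by auto
qed

text \<open>Any vertex is joined to one in the image by a walk, which lifts.\<close>

lemma covering_surj:
  assumes cov: "covering G (F, \<alpha>)" and conn: "connected_graph G"
  shows "fst \<alpha> ` verts F = verts G"
proof (intro equalityI subsetI)
  have connF: "connected_graph F" and hom: "graph_hom F G \<alpha>" using cov by auto
  show "w \<in> verts G" if "w \<in> fst \<alpha> ` verts F" for w using that hom by (auto simp: graph_hom_def)
  fix w assume w: "w \<in> verts G"
  obtain u where u: "u \<in> verts F" using connected_graphD(2)[OF connF] by blast
  then have "fst \<alpha> u \<in> verts G" using hom by (simp add: graph_hom_def)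
  then obtain p where "walk G (fst \<alpha> u) p w" using conn w by (auto simp: connected_graph_def)
  then obtain q v where "walk F u q v" "fst \<alpha> v = w"
    using covering_walk_lift[OF cov connected_graphD(1)[OF conn] u] by blast
  moreover from this have "v \<in> verts F"
    using wf_digraph.awalk_last_in_verts[OF wf_double_graph[OF connected_graphD(1)[OF connF]]]
    by fastforce
  ultimately show "w \<in> fst \<alpha> ` verts F" by blast
qed

lemma vertex_types_morphism:
  assumes bs: "bi_separated E C D"
    and X: "representation_graph E C D X" and Y: "representation_graph E C D Y"
    and \<alpha>: "over_morphism X Y \<alpha>"
  shows "vertex_types X = vertex_types Y"
proof -
  obtain F \<phi> G \<psi> where XY: "X = (F, \<phi>)" "Y = (G, \<psi>)" by (cases X; cases Y)
  note cov = over_morphism_covering[OF bs X[unfolded XY] Y[unfolded XY] \<alpha>[unfolded XY]]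
  have conn: "connected_graph G" using Y XY by simp
  have "walk_images (F, \<phi>) ` verts F = walk_images (G, \<psi>) ` (fst \<alpha> ` verts F)"
    using walk_images_morphism[OF cov connected_graphD(1)[OF conn] \<alpha>[unfolded XY]]
    by (simp add: image_image)
  then show ?thesis by (simp add: vertex_types_def XY covering_surj[OF cov conn])
qed

lemma vertex_types_in_component:
  fixes X :: "('v, 'e, 'a, 'b) over_graph" and Y :: "('w, 'f, 'a, 'b) over_graph"
  assumes bs: "bi_separated E C D" and comp: "\<C> \<in> RG_components E C D"
    and X: "in_component E C D \<C> X" and Y: "in_component E C D \<C> Y"
  shows "vertex_types X = vertex_types Y"
proof -
  let ?r = "RG_arrows E C D \<union> (RG_arrows E C D)\<inverse>"
  obtain Z where Z: "\<C> = ?r\<^sup>* `` {Z}"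
    using comp by (auto simp: RG_components_def elim: quotientE)
  have "vertex_types W = vertex_types Z" if "W \<in> \<C>" for W
  proof -
    have "(Z, W) \<in> ?r\<^sup>*" using that Z by simp
    then show ?thesis
    proof induction
      case (step V W)
      have "vertex_types V = vertex_types W"
        using step(2) vertex_types_morphism[OF bs] by (fastforce simp: RG_arrows_def RG_def)
      with step.IH show ?case by simp
    qed simp
  qed
  moreover have "\<exists>W\<in>\<C>. vertex_types U = vertex_types W" if U: "in_component E C D \<C> U"
    for U :: "('x, 'y, 'a, 'b) over_graph"
  proof -
    obtain W where W: "W \<in> \<C>" "over_iso U W" using U by (auto simp: in_component_def)
    obtain \<alpha> where \<alpha>: "over_morphism U W \<alpha>" using over_iso_morphisms(1)[OF W(2)] by blast
    have "representation_graph E C D W" "representation_graph E C D U"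
      using RG_component_subset[OF comp W(1)] U by (auto simp: RG_def in_component_def)
    then show ?thesis using W(1) vertex_types_morphism[OF bs _ _ \<alpha>] by blast
  qed
  ultimately show ?thesis using X Y by metis
qed

section \<open>The quotient by equality of types\<close>

lemma mem_walk_equiv:
  "(u, v) \<in> walk_equiv (F, \<phi>) \<longleftrightarrow>
     u \<in> verts F \<and> v \<in> verts F \<and> walk_images (F, \<phi>) u = walk_images (F, \<phi>) v"
  by (simp add: walk_images_def)

lemma equiv_walk_equiv: "equiv (verts F) (walk_equiv (F, \<phi>))"
  by (auto intro!: equivI refl_onI symI transI)

lemma equiv_arc_equiv:
  assumes "wf_digraph F"
  shows "equiv (arcs F) (arc_equiv (F, \<phi>) (walk_equiv (F, \<phi>)))"
  using wf_digraph.tail_in_verts[OF assms]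
  by (auto intro!: equivI refl_onI symI transI simp: mem_walk_equiv simp del: walk_equiv.simps)

text \<open>If all types of \<open>(G, \<psi>)\<close> occur in \<open>(F, \<phi>)\<close>, send each vertex to the class of
  all vertices of \<open>F\<close> of its type, and each edge to the class of the edge with the same image leaving
  such a vertex. For \<open>(G, \<psi>) = (F, \<phi>)\<close> this gives the projection to the quotient.\<close>

lemma quotient_attracts:
  fixes F :: "('v, 'e) pre_digraph" and G :: "('w, 'f) pre_digraph"
  assumes bs: "bi_separated E C D"
    and F: "representation_graph E C D (F, \<phi>)" and G: "representation_graph E C D (G, \<psi>)"
    and types: "vertex_types (G, \<psi>) \<subseteq> vertex_types (F, \<phi>)"
  shows "\<exists>\<alpha>. over_morphism (G, \<psi>) (quotient_over_graph (F, \<phi>) (walk_equiv (F, \<phi>))) \<alpha>"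
proof -
  define R where "R = walk_equiv (F, \<phi>)"
  define A where "A = arc_equiv (F, \<phi>) R"
  define S where "S = fst (quotient_over_graph (F, \<phi>) R)"
  define \<xi> where "\<xi> = snd (quotient_over_graph (F, \<phi>) R)"
  note simps = quotient_walk_equiv_simps[OF bs F, folded R_def, folded A_def S_def \<xi>_def]
  have V: "verts S = verts F // R" and Ar: "arcs S = arcs F // A" by (simp_all add: S_def A_def)
  have wfF: "wf_digraph F" and wfG: "wf_digraph G" using F G by (auto intro: connected_graphD)
  have "\<forall>v\<in>verts G. \<exists>u. u \<in> verts F \<and> walk_images (F, \<phi>) u = walk_images (G, \<psi>) v"
  proof
    fix v assume "v \<in> verts G"
    then have "walk_images (G, \<psi>) v \<in> walk_images (F, \<phi>) ` verts F"
      using types by (auto simp: vertex_types_def)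
    then show "\<exists>u. u \<in> verts F \<and> walk_images (F, \<phi>) u = walk_images (G, \<psi>) v" by auto
  qed
  then obtain \<sigma> where \<sigma>: "\<And>v. v \<in> verts G \<Longrightarrow> \<sigma> v \<in> verts F"
      "\<And>v. v \<in> verts G \<Longrightarrow> walk_images (F, \<phi>) (\<sigma> v) = walk_images (G, \<psi>) v"
    by metis
  have tG: "tail G e \<in> verts G" "head G e \<in> verts G" if "e \<in> arcs G" for e
    using wfG that by (auto simp: wf_digraph_def)
  have "\<forall>e\<in>arcs G. \<exists>f. f \<in> out_arcs F (\<sigma> (tail G e)) \<and> snd \<phi> f = snd \<psi> e"
    using walk_images_out_arc[OF wfG wfF \<sigma>(2)[OF tG(1), symmetric]] by metis
  then obtain \<rho> where \<rho>: "\<And>e. e \<in> arcs G \<Longrightarrow> \<rho> e \<in> arcs F"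
      "\<And>e. e \<in> arcs G \<Longrightarrow> tail F (\<rho> e) = \<sigma> (tail G e)" "\<And>e. e \<in> arcs G \<Longrightarrow> snd \<phi> (\<rho> e) = snd \<psi> e"
    by (metis in_out_arcs_conv)
  have head: "(head F (\<rho> e), \<sigma> (head G e)) \<in> R" if e: "e \<in> arcs G" for e
  proof -
    have "walk_images (F, \<phi>) (head F (\<rho> e)) = walk_images (G, \<psi>) (head G e)"
    proof (rule walk_images_step_eq[OF bs F G \<sigma>(2)[OF tG(1)[OF e]]])
      show "walk F (\<sigma> (tail G e)) [Inl (\<rho> e)] (head F (\<rho> e))" using \<rho> e by (auto simp: walk_single[OF wfF])
      show "walk G (tail G e) [Inl e] (head G e)" using e by (auto simp: walk_single[OF wfG])
    qed (use \<rho> e in simp)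
    then show ?thesis
      using \<sigma> tG e \<rho>(1)[OF e] wf_digraph.head_in_verts[OF wfF] by (simp add: R_def mem_walk_equiv del: walk_equiv.simps)
  qed
  have eqv: "equiv (verts F) R" unfolding R_def by (rule equiv_walk_equiv)
  let ?\<alpha> = "(\<lambda>v. R `` {\<sigma> v}, \<lambda>e. A `` {\<rho> e})"
  have "graph_hom G S ?\<alpha>"
    unfolding graph_hom_def using \<sigma>(1) \<rho> simps(3,4) equiv_class_eq[OF eqv head]
    by (auto simp: V Ar intro: quotientI)
  moreover have "map_eq_on G (\<xi> \<circ>\<^sub>g ?\<alpha>) \<psi>"
    using \<sigma> \<rho> simps(1,2) walk_images_base[OF \<sigma>(2)] by (auto simp: map_eq_on_def map_comp_graph_def)
  ultimately have "over_morphism (G, \<psi>) (S, \<xi>) ?\<alpha>" by simp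
  then have "\<exists>\<alpha>. over_morphism (G, \<psi>) (S, \<xi>) \<alpha>" by blast
  then show ?thesis by (simp only: S_def \<xi>_def R_def prod.collapse)
qed

text \<open>Fix a member \<open>u\<close> of a class. The edge at \<open>u\<close> over a given block gives one at the class. It is
  the only one: since all members have the same type, every edge at the class over this block has the
  image of some edge at \<open>u\<close>, and \<open>u\<close> has only one edge over the block.\<close>

lemma quotient_representation_graph:
  fixes F :: "('v, 'e) pre_digraph"
  assumes bs: "bi_separated E C D" and F: "representation_graph E C D (F, \<phi>)"
  shows "representation_graph E C D (quotient_over_graph (F, \<phi>) (walk_equiv (F, \<phi>)))"
proof -
  define R where "R = walk_equiv (F, \<phi>)"
  define A where "A = arc_equiv (F, \<phi>) R"
  define S where "S = fst (quotient_over_graph (F, \<phi>) R)"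
  define \<xi> where "\<xi> = snd (quotient_over_graph (F, \<phi>) R)"
  note simps = quotient_walk_equiv_simps[OF bs F, folded R_def, folded A_def S_def \<xi>_def]
  have V: "verts S = verts F // R" and Ar: "arcs S = arcs F // A" by (simp_all add: S_def A_def)
  have conn: "connected_graph F" and hom: "graph_hom F E \<phi>" using F by auto
  note wf = connected_graphD[OF conn]
  have eqv: "equiv (verts F) R" unfolding R_def by (rule equiv_walk_equiv)
  have eqa: "equiv (arcs F) A" unfolding A_def R_def by (rule equiv_arc_equiv[OF wf(1)])
  have memR: "(u, v) \<in> R \<longleftrightarrow> u \<in> verts F \<and> v \<in> verts F \<and>
      walk_images (F, \<phi>) u = walk_images (F, \<phi>) v" for u v
    unfolding R_def by (rule mem_walk_equiv)
  have memA: "(e, f) \<in> A \<longleftrightarrow> e \<in> arcs F \<and> f \<in> arcs F \<and> (tail F e, tail F f) \<in> R \<and> snd \<phi> e = snd \<phi> f"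
    for e f by (simp add: A_def)
  have wfS: "wf_digraph S"
    unfolding wf_digraph_def V Ar using simps(3,4) by (auto elim!: quotientE intro!: quotientI wf(3,4))
  have proj: "graph_hom F S (\<lambda>v. R `` {v}, \<lambda>e. A `` {e})"
    using simps(3,4) by (auto simp: graph_hom_def V Ar intro: quotientI)
  have "connected_graph S"
    unfolding connected_graph_def
  proof (intro conjI ballI)
    show "wf_digraph S" by (fact wfS)
    show "verts S \<noteq> {}" using wf(2) by (simp add: V)
    fix U W assume "U \<in> verts S" "W \<in> verts S"
    then obtain u w where uw: "u \<in> verts F" "U = R `` {u}" "w \<in> verts F" "W = R `` {w}"
      by (auto simp: V elim!: quotientE)
    then obtain p where "walk F u p w" using conn unfolding connected_graph_def by blast
    from walk_hom[OF wf(1) wfS proj this] show "\<exists>p. walk S U p W" using uw by auto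
  qed
  moreover have "graph_hom S E \<xi>"
    unfolding graph_hom_def
  proof (intro conjI ballI)
    show "fst \<xi> U \<in> verts E" if "U \<in> verts S" for U
      using that hom simps(1) by (auto simp: V graph_hom_def elim!: quotientE)
    fix B assume "B \<in> arcs S"
    then obtain e where e: "e \<in> arcs F" "B = A `` {e}" by (auto simp: Ar elim!: quotientE)
    with hom wf(3,4) simps show "snd \<xi> B \<in> arcs E" "tail E (snd \<xi> B) = fst \<xi> (tail S B)"
      "head E (snd \<xi> B) = fst \<xi> (head S B)"
      by (auto simp: graph_hom_def)
  qed
  moreover have "\<exists>!B. B \<in> out_arcs S U \<and> snd \<xi> B \<in> X"
    if "U \<in> verts S" and X: "X \<in> C (fst \<xi> U)" for U X
  proof -
    obtain u where u: "u \<in> verts F" "U = R `` {u}" using \<open>U \<in> verts S\<close> by (auto simp: V elim!: quotientE)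
    then have "\<exists>!f. f \<in> out_arcs F u \<and> snd \<phi> f \<in> X" using F X simps(1) by auto
    then obtain f where f: "f \<in> out_arcs F u" "snd \<phi> f \<in> X"
        "\<And>g. g \<in> out_arcs F u \<Longrightarrow> snd \<phi> g \<in> X \<Longrightarrow> g = f" by blast
    show ?thesis
    proof (rule ex1I[of _ "A `` {f}"])
      show "A `` {f} \<in> out_arcs S U \<and> snd \<xi> (A `` {f}) \<in> X"
        using f(1,2) u simps by (auto simp: Ar intro: quotientI)
      fix B assume B: "B \<in> out_arcs S U \<and> snd \<xi> B \<in> X"
      then obtain g where g: "g \<in> arcs F" "B = A `` {g}" by (auto simp: Ar elim!: quotientE)
      then have "(tail F g, u) \<in> R"
        using B u wf(3) simps(3) eq_equiv_class_iff[OF eqv] by auto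
      moreover from this obtain g' where g': "g' \<in> out_arcs F u" "snd \<phi> g' = snd \<phi> g"
        using walk_images_out_arc[OF wf(1) wf(1) _ g(1)] memR by metis
      moreover have "g' = f" using f(3)[OF g'(1)] g' g B simps(2) by auto
      ultimately have "(g, f) \<in> A" using g(1) by (auto simp: memA)
      then show "B = A `` {f}" using g(2) equiv_class_eq[OF eqa] by simp
    qed
  qed
  moreover have "\<exists>!B. B \<in> in_arcs S U \<and> snd \<xi> B \<in> Y"
    if "U \<in> verts S" and Y: "Y \<in> D (fst \<xi> U)" for U Y
  proof -
    obtain u where u: "u \<in> verts F" "U = R `` {u}" using \<open>U \<in> verts S\<close> by (auto simp: V elim!: quotientE)
    then have "\<exists>!f. f \<in> in_arcs F u \<and> snd \<phi> f \<in> Y" using F Y simps(1) by auto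
    then obtain f where f: "f \<in> in_arcs F u" "snd \<phi> f \<in> Y"
        "\<And>g. g \<in> in_arcs F u \<Longrightarrow> snd \<phi> g \<in> Y \<Longrightarrow> g = f" by blast
    show ?thesis
    proof (rule ex1I[of _ "A `` {f}"])
      show "A `` {f} \<in> in_arcs S U \<and> snd \<xi> (A `` {f}) \<in> Y"
        using f(1,2) u simps by (auto simp: Ar intro: quotientI)
      fix B assume B: "B \<in> in_arcs S U \<and> snd \<xi> B \<in> Y"
      then obtain g where g: "g \<in> arcs F" "B = A `` {g}" by (auto simp: Ar elim!: quotientE)
      then have hR: "(head F g, u) \<in> R"
        using B u wf(4) simps(4) eq_equiv_class_iff[OF eqv] by auto
      then obtain g' where g': "g' \<in> in_arcs F u" "snd \<phi> g' = snd \<phi> g"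
        using walk_images_in_arc[OF wf(1) wf(1) _ g(1)] memR by metis
      moreover have "g' = f" using f(3)[OF g'(1)] g' g B simps(2) by auto
      \<comment> \<open>edges are identified by their sources, so the equality of types is carried backwards along
        the edges from the common range\<close>
      moreover have "(tail F g, tail F f) \<in> R"
      proof -
        have "walk_images (F, \<phi>) (tail F g) = walk_images (F, \<phi>) (tail F f)"
        proof (rule walk_images_step_eq[OF bs F F])
          show "walk_images (F, \<phi>) (head F g) = walk_images (F, \<phi>) u" using hR memR by simp
          show "walk F (head F g) [Inr g] (tail F g)" using g by (auto simp: walk_single[OF wf(1)])
          show "walk F u [Inr f] (tail F f)" using f(1) by (auto simp: walk_single[OF wf(1)])
        qed (use calculation in simp)
        then show ?thesis using g(1) f(1) wf(3) by (simp add: memR)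
      qed
      ultimately have "(g, f) \<in> A" using g(1) by (auto simp: memA)
      then show "B = A `` {f}" using g(2) equiv_class_eq[OF eqa] by simp
    qed
  qed
  ultimately have "representation_graph E C D (S, \<xi>)" by simp
  then show ?thesis by (simp only: S_def \<xi>_def R_def prod.collapse)
qed

section \<open>The attracting object\<close>

theorem theorem3p18:
  fixes E :: "('a, 'b) pre_digraph"
    and C D :: "'a \<Rightarrow> 'b set set"
    and \<C> :: "('a, 'b) std_over_graph set"
    and F :: "('v, 'e) pre_digraph" and \<phi> :: "('v, 'e, 'a, 'b) graph_map"
    and T :: "('t, 's) pre_digraph" and \<tau> :: "('t, 's, 'v, 'e) graph_map"
    and S :: "('t set, 's set) pre_digraph" and \<xi> :: "('t set, 's set, 'a, 'b) graph_map"
  assumes "bi_separated E C D"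
    and "\<C> \<in> RG_components E C D"
    and "in_component E C D \<C> (F, \<phi>)"
    and "universal_covering F (T, \<tau>)"
    and "(S, \<xi>) = quotient_over_graph (T, \<phi> \<circ>\<^sub>g \<tau>) (walk_equiv (T, \<phi> \<circ>\<^sub>g \<tau>))"
  shows "in_component E C D \<C> (S, \<xi>) \<and>
    (\<forall>X :: ('w, 'f, 'a, 'b) over_graph. in_component E C D \<C> X \<longrightarrow> (\<exists>\<alpha>. over_morphism X (S, \<xi>) \<alpha>)) \<and>
    (\<forall>(G :: ('w, 'f) pre_digraph) \<eta>. in_component E C D \<C> (G, \<eta>) \<longleftrightarrow>
       (\<exists>\<alpha>. covering S (G, \<alpha>) \<and> map_eq_on G \<eta> (\<xi> \<circ>\<^sub>g \<alpha>)))"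
proof -
  note bs = assms(1) and comp = assms(2) and inF = assms(3)
  have repF: "representation_graph E C D (F, \<phi>)" using inF by (simp add: in_component_def)
  have "covering F (T, \<tau>)" using assms(4) by (simp add: universal_covering_def)
  note T = covering_representation_graph[OF this repF, of "\<phi> \<circ>\<^sub>g \<tau>"]
  have repT: "representation_graph E C D (T, \<phi> \<circ>\<^sub>g \<tau>)"
    and morT: "over_morphism (T, \<phi> \<circ>\<^sub>g \<tau>) (F, \<phi>) \<tau>"
    using T by (simp_all add: map_eq_on_def)
  have inT: "in_component E C D \<C> (T, \<phi> \<circ>\<^sub>g \<tau>)"
    using in_component_morphism[OF bs comp repT repF morT] inF by simp
  have repS: "representation_graph E C D (S, \<xi>)"
    unfolding assms(5) by (rule quotient_representation_graph[OF bs repT])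
  obtain \<pi> where \<pi>: "over_morphism (T, \<phi> \<circ>\<^sub>g \<tau>) (S, \<xi>) \<pi>"
    using quotient_attracts[OF bs repT repT order.refl] unfolding assms(5) by blast
  have inS: "in_component E C D \<C> (S, \<xi>)"
    using in_component_morphism[OF bs comp repT repS \<pi>] inT by simp
  have attract: "\<exists>\<alpha>. over_morphism X (S, \<xi>) \<alpha>" if X: "in_component E C D \<C> X"
    for X :: "('w, 'f, 'a, 'b) over_graph"
  proof -
    obtain G \<psi> where G: "X = (G, \<psi>)" by (cases X)
    have "representation_graph E C D (G, \<psi>)" using X G by (simp add: in_component_def)
    moreover have "vertex_types (G, \<psi>) \<subseteq> vertex_types (T, \<phi> \<circ>\<^sub>g \<tau>)"
      using vertex_types_in_component[OF bs comp X inT] G by simp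
    ultimately show ?thesis unfolding G assms(5) by (rule quotient_attracts[OF bs repT])
  qed
  have "in_component E C D \<C> (G, \<eta>) \<longleftrightarrow> (\<exists>\<alpha>. covering S (G, \<alpha>) \<and> map_eq_on G \<eta> (\<xi> \<circ>\<^sub>g \<alpha>))"
    for G :: "('w, 'f) pre_digraph" and \<eta>
  proof
    assume inG: "in_component E C D \<C> (G, \<eta>)"
    then obtain \<alpha> where \<alpha>: "over_morphism (G, \<eta>) (S, \<xi>) \<alpha>" using attract by blast
    have repG: "representation_graph E C D (G, \<eta>)" using inG by (simp add: in_component_def)
    have "map_eq_on G \<eta> (\<xi> \<circ>\<^sub>g \<alpha>)" using \<alpha> by (simp add: map_eq_on_def)
    with over_morphism_covering[OF bs repG repS \<alpha>]
    show "\<exists>\<alpha>. covering S (G, \<alpha>) \<and> map_eq_on G \<eta> (\<xi> \<circ>\<^sub>g \<alpha>)" by blast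
  next
    assume "\<exists>\<alpha>. covering S (G, \<alpha>) \<and> map_eq_on G \<eta> (\<xi> \<circ>\<^sub>g \<alpha>)"
    then obtain \<alpha> where "covering S (G, \<alpha>)" "map_eq_on G \<eta> (\<xi> \<circ>\<^sub>g \<alpha>)" by blast
    note G = covering_representation_graph[OF this(1) repS this(2)]
    show "in_component E C D \<C> (G, \<eta>)"
      using in_component_morphism[OF bs comp G(1) repS G(2)] inS by simp
  qed
  with inS attract show ?thesis by blast
qed

end
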